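(* Let $\gamma\in(\sqrt{3/2},3/2)$ and suppose that Assumption 1 and Assumption 2 (stated in the context) hold for this $\gamma$. Then for every $\delta>0$ there exists $n_1$ such that for every $n_0\ge n_1$, when the Slack-Pack algorithm is run with parameters $n_0$ and $\gamma$, every critical time moment $t\in T_{crit}$ satisfies $$\frac{S_{LRP}(t)}{S_{com}(t)}>1-\frac1\gamma-\delta,$$ and consequently the Slack-Pack algorithm never fails and produces a perfect packing of the details $D_n$, $n\ge n_0$, into the sheet.
   Context: Fix an integer $n_0\ge1$ and a real parameter $\gamma$ with $\sqrt{3/2}<\gamma<3/2$. The details are either all the rectangles $R_n$ with side lengths $\frac1n\times\frac1{n+1}$, $n\ge n_0$, or all the squares $S_n$ with side length $\frac1n$, $n\ge n_0$ (the statement is claimed for each of the two families); $D_n$ denotes the $n$-th detail. For a rectangle $X$, its width $w(X)$ is its shorter side length, its height $h(X)$ its longer side length, and $S(X)=w(X)h(X)$. For $t\ge n_0$ let $S_{com}(t)=\sum_{n\ge t}S(D_n)$. The sheet is a square of area $S_{com}(n_0)$. A perfect packing is a placement of all details in the sheet with pairwise disjoint interiors (total area of details equals the sheet area). Slack-Pack algorithm (guillotine cuts only). It maintains a rectangle LRP in a corner of the sheet (initially the whole sheet), a finite set $\mathcal B$ of empty rectangular boxes (initially empty), an active box $B_{act}$, and an index $N$. (1) Set $n=n_0$, $N=n_0$, $\mathcal B=\emptyset$; go to (3). (2) If $h(B_{act})\ge h(D_n)+N^{-\gamma}$ go to (5); otherwise go to (3). (3) Set $N=n$. If $\mathcal B=\emptyset$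 go to (4). Otherwise let $B_{max}$ be a box of maximal width in $\mathcal B$; if $w(B_{max})\ge w(D_n)+n^{-\gamma}$, set $B_{act}=B_{max}$ and go to (5); otherwise go to (4). (4) If $w(LRP)<h(D_n)+n^{-\gamma}$, the algorithm fails. Otherwise cut from the LRP a stripe with side lengths $w(LRP)$ and $w(D_n)+n^{-\gamma}$; the remainder, with side lengths $w(LRP)$ and $h(LRP)-w(D_n)-n^{-\gamma}$, is the new LRP. Set $B_{act}$ to be the stripe, add it to $\mathcal B$, go to (5). (5) Place $D_n$ in a corner of $B_{act}$ and cut, obtaining an endpoint with side lengths $w(B_{act})$ and $h(B_{act})-h(D_n)$ and a normal box $B_n$ with side lengths $h(D_n)$ and $w(B_{act})-w(D_n)$; replace $B_{act}$ in $\mathcal B$ by these two boxes, set $B_{act}$ to be the endpoint, set $n=n+1$, go to (2). The time moment $t$ is the moment when $D_{n_0},\dots,D_{t-1}$ are packed and $D_t$ is to be packed; $\mathcal B(t)$ is the set of boxes at that moment, split into normal boxes $\mathcal B_{norm}(t)$ and endpoints $\mathcal B_{ep}(t)$. A row is the sequence of consecutive details packed after a visit to step (3) (in the box chosen in (3) or the stripe cut in (4), then in successive endpoints) until the next visit to (3). Normal boxes of the first kind are those created in a row whose initial active box is a stripe; of the second kind, those created in a row whose initial active box was chosen from $\mathcal B$ in step (3). Endpoints of the first kind are those created in a row whose initial active box is a stripe or an endpoint of the first kind; of the second kind, those created in a row whose initial active box is a normal box or an endpoint of the second kind. $\mathcal B_{norm,1}(t),\mathcal B_{norm,2}(t),\mathcal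 B_{ep,1}(t),\mathcal B_{ep,2}(t)$ are the corresponding subsets of $\mathcal B(t)$. $S_{LRP}(t)$ is the area of the LRP at moment $t$, and $S_{norm}(t)$, $S_{ep,2}(t)$, etc. are total areas of the corresponding sets of boxes. $T_{crit}$ is the set of critical time moments: the moments $t$ at which step (4) has to be executed for $D_t$. $t_0$ is the first time moment at which a normal box is chosen as the active box in step (3). Assumption 1 (for the given $\gamma$): for every $\sigma>0$ there is $n_1$ such that for all $n_0\ge n_1$, every normal box $B$ created by the algorithm satisfies $h(B)^\gamma(1+\sigma)\ge w(B)$. Assumption 2 (for the given $\gamma$): for all sufficiently large $n_0$ and all $t\in T_{crit}$ with $t>t_0$, $\frac{1}{|\mathcal B_{ep,2}(t)|}\sum_{B\in\mathcal B_{ep,2}(t)}\frac{h(B)}{w(B)}=O(\ln t)$.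
   Formalization: In steps (2) and (5), within a row, h and w of the active box mean its extent along and across the row (fixed at the row's start) rather than its longer and shorter side; with the literal reading the test of step (2) can pass for a last short endpoint in which the detail does not fit. *)

theory Defs
  imports "HOL-Analysis.Analysis"
begin

section \<open>Rectangles\<close>

text \<open>\<open>Rect x y a b\<close> is the axis-parallel rectangle with lower left corner \<open>(x, y)\<close>,
  horizontal side length \<open>a\<close> and vertical side length \<open>b\<close>.\<close>

datatype rect = Rect (xpos: real) (ypos: real) (xlen: real) (ylen: real)

definition region :: "rect \<Rightarrow> (real \<times> real) set" where
  "region R = cbox (xpos R, ypos R) (xpos R + xlen R, ypos R + ylen R)"

definition width :: "rect \<Rightarrow> real" where
  "width R = min (xlen R) (ylen R)"

definition height :: "rect \<Rightarrow> real" where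
  "height R = max (xlen R) (ylen R)"

definition area :: "rect \<Rightarrow> real" where
  "area R = width R * height R"

datatype dir = Horizontal | Vertical

fun across :: "dir \<Rightarrow> dir" where
  "across Horizontal = Vertical"
| "across Vertical = Horizontal"

fun extent :: "dir \<Rightarrow> rect \<Rightarrow> real" where
  "extent Horizontal R = xlen R"
| "extent Vertical R = ylen R"

text \<open>A guillotine cut orthogonal to direction \<open>d\<close> splits \<open>R\<close> into a part \<open>cut_off d l R\<close> of
  extent \<open>l\<close> in direction \<open>d\<close> (at the lower or left end) and the remainder \<open>cut_rest d l R\<close>.\<close>

fun cut_off :: "dir \<Rightarrow> real \<Rightarrow> rect \<Rightarrow> rect" where
  "cut_off Horizontal l (Rect x y a b) = Rect x y l b"
| "cut_off Vertical l (Rect x y a b) = Rect x y a l"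

fun cut_rest :: "dir \<Rightarrow> real \<Rightarrow> rect \<Rightarrow> rect" where
  "cut_rest Horizontal l (Rect x y a b) = Rect (x + l) y (a - l) b"
| "cut_rest Vertical l (Rect x y a b) = Rect x (y + l) a (b - l)"

definition long_dir :: "rect \<Rightarrow> dir" where
  "long_dir R = (if ylen R \<le> xlen R then Horizontal else Vertical)"


section \<open>Details, sheet, perfect packings\<close>

datatype family = Rectangles | Squares

fun wD :: "family \<Rightarrow> nat \<Rightarrow> real" where
  "wD Rectangles n = 1 / (real n + 1)"
| "wD Squares n = 1 / real n"

fun hD :: "family \<Rightarrow> nat \<Rightarrow> real" where
  "hD Rectangles n = 1 / real n"
| "hD Squares n = 1 / real n"

definition S_com :: "family \<Rightarrow> nat \<Rightarrow> real" where
  "S_com F t = (\<Sum>k. wD F (t + k) * hD F (t + k))"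

definition sheet :: "family \<Rightarrow> nat \<Rightarrow> rect" where
  "sheet F n0 = Rect 0 0 (sqrt (S_com F n0)) (sqrt (S_com F n0))"

definition perfect_packing :: "family \<Rightarrow> nat \<Rightarrow> (nat \<Rightarrow> rect) \<Rightarrow> bool" where
  "perfect_packing F n0 P \<longleftrightarrow>
     (\<forall>n\<ge>n0. width (P n) = wD F n \<and> height (P n) = hD F n \<and>
             region (P n) \<subseteq> region (sheet F n0)) \<and>
     (\<forall>m\<ge>n0. \<forall>n\<ge>n0. m \<noteq> n \<longrightarrow>
        interior (region (P m)) \<inter> interior (region (P n)) = {}) \<and>
     (\<lambda>k. area (P (n0 + k))) sums area (sheet F n0)"


section \<open>The Slack-Pack algorithm\<close>

text \<open>Every box carries its kind, so that the subsets of the set of boxes according to kind are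
  available at every time moment. A stripe is only a member of the set of boxes between its creation
  and the placement of the first detail into it.\<close>

datatype kind = Stripe | Normal1 | Normal2 | Endpoint1 | Endpoint2

datatype box = Box (kind: kind) (shape: rect)

abbreviation w :: "box \<Rightarrow> real" where "w B \<equiv> width (shape B)"
abbreviation h :: "box \<Rightarrow> real" where "h B \<equiv> height (shape B)"

text \<open>The argument is the kind of the initial active box of the row.\<close>

definition normal_kind :: "kind \<Rightarrow> kind" where
  "normal_kind k = (if k = Stripe then Normal1 else Normal2)"

definition endpoint_kind :: "kind \<Rightarrow> kind" where
  "endpoint_kind k = (if k = Stripe \<or> k = Endpoint1 then Endpoint1 else Endpoint2)"

text \<open>\<open>active\<close> is \<open>None\<close> only before the first detail is packed. The direction of a row is the
  direction of the longer side of its initial active box, and it is kept throughout the row. While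
  the row is being filled, the role of \<open>h\<close> of the active box is played by its extent in the
  direction of the row and the role of \<open>w\<close> by its extent across that direction: the last endpoints
  of a row may well be shorter along the row than across it, and the next detail of the row fits
  only if there is enough room along the row.\<close>

record state =
  lrp :: rect
  boxes :: "box set"
  active :: "box option"
  row_dir :: dir
  row_kind :: kind   \<comment> \<open>kind of the initial active box of the current row\<close>
  row_start :: nat   \<comment> \<open>the index \<open>N\<close>\<close>
  placed :: "nat \<Rightarrow> rect option"

text \<open>A choice function \<open>pick\<close> resolves the ties in the selection of a box of maximal width. It may
  depend on \<open>n0\<close> and on the number of the current detail, so that every run is obtained for some
  \<open>pick\<close>.\<close>

type_synonym choice = "nat \<Rightarrow> nat \<Rightarrow> box set \<Rightarrow> box"

definition max_width_choice :: "choice \<Rightarrow> bool" where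
  "max_width_choice pick \<longleftrightarrow>
     (\<forall>n0 n \<B>. finite \<B> \<longrightarrow> \<B> \<noteq> {} \<longrightarrow>
        pick n0 n \<B> \<in> \<B> \<and> (\<forall>B\<in>\<B>. w B \<le> w (pick n0 n \<B>)))"

definition slack :: "real \<Rightarrow> nat \<Rightarrow> real" where
  "slack \<gamma> n = real n powr (- \<gamma>)"

definition step1 :: "family \<Rightarrow> nat \<Rightarrow> state" where
  "step1 F n0 = \<lparr>lrp = sheet F n0, boxes = {}, active = None, row_dir = Horizontal,
     row_kind = Stripe, row_start = n0, placed = (\<lambda>_. None)\<rparr>"

definition continues_row :: "family \<Rightarrow> real \<Rightarrow> nat \<Rightarrow> state \<Rightarrow> bool" where
  "continues_row F \<gamma> n s \<longleftrightarrow>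
     (case active s of None \<Rightarrow> False
      | Some B \<Rightarrow> extent (row_dir s) (shape B) \<ge> hD F n + slack \<gamma> (row_start s))"

definition box_available :: "family \<Rightarrow> real \<Rightarrow> choice \<Rightarrow> nat \<Rightarrow> nat \<Rightarrow> state \<Rightarrow> bool" where
  "box_available F \<gamma> pick n0 n s \<longleftrightarrow>
     boxes s \<noteq> {} \<and> w (pick n0 n (boxes s)) \<ge> wD F n + slack \<gamma> n"

definition start_row :: "nat \<Rightarrow> box \<Rightarrow> state \<Rightarrow> state" where
  "start_row n B s = s\<lparr>active := Some B, row_dir := long_dir (shape B), row_kind := kind B,
     row_start := n\<rparr>"

definition step5 :: "family \<Rightarrow> nat \<Rightarrow> state \<Rightarrow> state" where
  "step5 F n s =
     (let B = the (active s); d = row_dir s;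
          piece = cut_off d (hD F n) (shape B);
          E = Box (endpoint_kind (row_kind s)) (cut_rest d (hD F n) (shape B));
          M = Box (normal_kind (row_kind s)) (cut_rest (across d) (wD F n) piece)
      in s\<lparr>boxes := (boxes s - {B}) \<union> {E, M}, active := Some E,
           placed := (placed s)(n \<mapsto> cut_off (across d) (wD F n) piece)\<rparr>)"

text \<open>\<open>None\<close> means that the algorithm fails.\<close>

definition step4 :: "family \<Rightarrow> real \<Rightarrow> nat \<Rightarrow> state \<Rightarrow> state option" where
  "step4 F \<gamma> n s =
     (if width (lrp s) < hD F n + slack \<gamma> n then None
      else
        (let d = long_dir (lrp s); l = wD F n + slack \<gamma> n;
             B = Box Stripe (cut_off d l (lrp s))
         in Some (step5 F n (start_row n B
              (s\<lparr>lrp := cut_rest d l (lrp s), boxes := insert B (boxes s)\<rparr>)))))"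

definition step3 :: "family \<Rightarrow> real \<Rightarrow> choice \<Rightarrow> nat \<Rightarrow> nat \<Rightarrow> state \<Rightarrow> state option" where
  "step3 F \<gamma> pick n0 n s =
     (if box_available F \<gamma> pick n0 n s
      then Some (step5 F n (start_row n (pick n0 n (boxes s)) s))
      else step4 F \<gamma> n s)"

definition step2 :: "family \<Rightarrow> real \<Rightarrow> choice \<Rightarrow> nat \<Rightarrow> nat \<Rightarrow> state \<Rightarrow> state option" where
  "step2 F \<gamma> pick n0 n s =
     (if continues_row F \<gamma> n s then Some (step5 F n s) else step3 F \<gamma> pick n0 n s)"

text \<open>\<open>run F \<gamma> pick n0 k\<close> is the state after \<open>k\<close> details have been packed, or \<open>None\<close> if the
  algorithm has failed before. Before the first detail there is no active box, so \<open>step2\<close> passes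
  control to \<open>step3\<close>.\<close>

primrec run :: "family \<Rightarrow> real \<Rightarrow> choice \<Rightarrow> nat \<Rightarrow> nat \<Rightarrow> state option" where
  "run F \<gamma> pick n0 0 = Some (step1 F n0)"
| "run F \<gamma> pick n0 (Suc k) = Option.bind (run F \<gamma> pick n0 k) (step2 F \<gamma> pick n0 (n0 + k))"

definition moment :: "family \<Rightarrow> real \<Rightarrow> choice \<Rightarrow> nat \<Rightarrow> nat \<Rightarrow> state option" where
  "moment F \<gamma> pick n0 t = (if t < n0 then None else run F \<gamma> pick n0 (t - n0))"


section \<open>Quantities attached to a run\<close>

definition never_fails :: "family \<Rightarrow> real \<Rightarrow> choice \<Rightarrow> nat \<Rightarrow> bool" where
  "never_fails F \<gamma> pick n0 \<longleftrightarrow> (\<forall>t\<ge>n0. moment F \<gamma> pick n0 t \<noteq> None)"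

definition placement :: "family \<Rightarrow> real \<Rightarrow> choice \<Rightarrow> nat \<Rightarrow> nat \<Rightarrow> rect" where
  "placement F \<gamma> pick n0 n = the (placed (the (moment F \<gamma> pick n0 (Suc n))) n)"

definition S_LRP :: "family \<Rightarrow> real \<Rightarrow> choice \<Rightarrow> nat \<Rightarrow> nat \<Rightarrow> real" where
  "S_LRP F \<gamma> pick n0 t = area (lrp (the (moment F \<gamma> pick n0 t)))"

definition boxes_at :: "family \<Rightarrow> real \<Rightarrow> choice \<Rightarrow> nat \<Rightarrow> nat \<Rightarrow> box set" where
  "boxes_at F \<gamma> pick n0 t =
     (case moment F \<gamma> pick n0 t of None \<Rightarrow> {} | Some s \<Rightarrow> boxes s)"

definition B_norm :: "family \<Rightarrow> real \<Rightarrow> choice \<Rightarrow> nat \<Rightarrow> nat \<Rightarrow> box set" where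
  "B_norm F \<gamma> pick n0 t = {B \<in> boxes_at F \<gamma> pick n0 t. kind B \<in> {Normal1, Normal2}}"

definition B_ep2 :: "family \<Rightarrow> real \<Rightarrow> choice \<Rightarrow> nat \<Rightarrow> nat \<Rightarrow> box set" where
  "B_ep2 F \<gamma> pick n0 t = {B \<in> boxes_at F \<gamma> pick n0 t. kind B = Endpoint2}"

text \<open>A moment at which \<open>step4\<close> has to be executed is critical even if \<open>step4\<close> fails there.\<close>

definition T_crit :: "family \<Rightarrow> real \<Rightarrow> choice \<Rightarrow> nat \<Rightarrow> nat set" where
  "T_crit F \<gamma> pick n0 =
     {t. \<exists>s. moment F \<gamma> pick n0 t = Some s \<and> \<not> continues_row F \<gamma> t s \<and>
             \<not> box_available F \<gamma> pick n0 t s}"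

definition chooses_normal :: "family \<Rightarrow> real \<Rightarrow> choice \<Rightarrow> nat \<Rightarrow> nat \<Rightarrow> bool" where
  "chooses_normal F \<gamma> pick n0 t \<longleftrightarrow>
     (\<exists>s. moment F \<gamma> pick n0 t = Some s \<and> \<not> continues_row F \<gamma> t s \<and>
          box_available F \<gamma> pick n0 t s \<and>
          kind (pick n0 t (boxes s)) \<in> {Normal1, Normal2})"

text \<open>The moment \<open>t0\<close>, as a predicate because it need not exist for a failing run.\<close>

definition is_t0 :: "family \<Rightarrow> real \<Rightarrow> choice \<Rightarrow> nat \<Rightarrow> nat \<Rightarrow> bool" where
  "is_t0 F \<gamma> pick n0 t0 \<longleftrightarrow>
     chooses_normal F \<gamma> pick n0 t0 \<and> (\<forall>t<t0. \<not> chooses_normal F \<gamma> pick n0 t)"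


section \<open>The two assumptions\<close>

text \<open>A normal box created together with the placement of \<open>D\<^sub>n\<close> belongs to the set of boxes at the
  moment \<open>n + 1\<close>, so the normal boxes created are those occurring in \<open>B_norm\<close> at some moment.\<close>

definition assumption1 :: "family \<Rightarrow> real \<Rightarrow> choice \<Rightarrow> bool" where
  "assumption1 F \<gamma> pick \<longleftrightarrow>
     (\<forall>\<sigma>>0. \<exists>n1\<ge>1. \<forall>n0\<ge>n1. \<forall>t. \<forall>B\<in>B_norm F \<gamma> pick n0 t.
        h B powr \<gamma> * (1 + \<sigma>) \<ge> w B)"

text \<open>The constant in \<open>O(ln t)\<close> is uniform in \<open>n0\<close>.\<close>

definition assumption2 :: "family \<Rightarrow> real \<Rightarrow> choice \<Rightarrow> bool" where
  "assumption2 F \<gamma> pick \<longleftrightarrow>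
     (\<exists>C. \<exists>n1\<ge>1. \<forall>n0\<ge>n1. \<forall>t0. is_t0 F \<gamma> pick n0 t0 \<longrightarrow>
        (\<forall>t\<in>T_crit F \<gamma> pick n0. t > t0 \<longrightarrow>
           1 / real (card (B_ep2 F \<gamma> pick n0 t)) * (\<Sum>B\<in>B_ep2 F \<gamma> pick n0 t. h B / w B)
             \<le> C * ln (real t)))"

end

theory Submission
  imports Defs "HOL-Real_Asymp.Real_Asymp"
begin

text \<open>At a critical moment \<open>t\<close> every box is narrower than \<open>u = 1/t + t\<^sup>-\<^sup>\<gamma>\<close>, and the area of the LRP
  is the remaining area minus the area of the boxes. The normal box created with \<open>D\<^sub>m\<close> has height
  \<open>1/m\<close> and, by the slack and Assumption 1, width between \<open>m\<^sup>-\<^sup>\<gamma>\<close> and \<open>(1 + \<sigma>) m\<^sup>-\<^sup>\<gamma>\<close>; hence only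
  \<open>m \<ge> u\<^sup>-\<^sup>1\<^sup>/\<^sup>\<gamma>\<close> contribute and the normal boxes have total area about \<open>1/(\<gamma>t)\<close>.
  An endpoint of the first kind goes back to a stripe, cut at some moment \<open>N\<close>, and has height at
  most \<open>2/N\<close>; since the LRP has aspect ratio at most 2, cutting the stripe lowers the square root of the
  area of the LRP by a multiple of \<open>1/N\<close>, so that the heights of these endpoints sum to \<open>O(n0\<^sup>-\<^sup>1\<^sup>/\<^sup>2)\<close>.
  There are \<open>O(t\<^sup>1\<^sup>/\<^sup>\<gamma>)\<close> endpoints of the second kind, and their total area is at most \<open>u\<^sup>2\<close> times the
  sum of their ratios \<open>h/w\<close>, which is \<open>o(1/t)\<close> by Assumption 2. Thus the LRP keeps a share of about
  \<open>1 - 1/\<gamma>\<close> of the remaining area, and a rectangle of that area and of bounded aspect ratio is wide enough for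
  the next stripe.\<close>

section \<open>Rectangles\<close>

definition inside :: "rect \<Rightarrow> rect \<Rightarrow> bool" where
  "inside R S \<longleftrightarrow> xpos S \<le> xpos R \<and> xpos R + xlen R \<le> xpos S + xlen S \<and>
     ypos S \<le> ypos R \<and> ypos R + ylen R \<le> ypos S + ylen S"

definition apart :: "rect \<Rightarrow> rect \<Rightarrow> bool" where
  "apart R S \<longleftrightarrow> xpos R + xlen R \<le> xpos S \<or> xpos S + xlen S \<le> xpos R \<or>
     ypos R + ylen R \<le> ypos S \<or> ypos S + ylen S \<le> ypos R"

definition proper :: "rect \<Rightarrow> bool" where
  "proper R \<longleftrightarrow> 0 < xlen R \<and> 0 < ylen R"

lemma inside_refl: "inside R R"
  by (simp add: inside_def)

lemma inside_trans: "inside R S \<Longrightarrow> inside S T \<Longrightarrow> inside R T"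
  unfolding inside_def by linarith

lemma apart_sym: "apart R S \<Longrightarrow> apart S R"
  unfolding apart_def by blast

lemma apart_inside: "apart R S \<Longrightarrow> inside R' R \<Longrightarrow> inside S' S \<Longrightarrow> apart R' S'"
  unfolding apart_def inside_def by linarith

lemma apart_inside_left: "apart R S \<Longrightarrow> inside R' R \<Longrightarrow> apart R' S"
  by (rule apart_inside[OF _ _ inside_refl])

lemma apart_irrefl: "proper R \<Longrightarrow> \<not> apart R R"
  unfolding proper_def apart_def by simp

lemma inside_width: "inside R S \<Longrightarrow> width R \<le> width S"
  unfolding inside_def width_def by linarith

lemma inside_height: "inside R S \<Longrightarrow> height R \<le> height S"
  unfolding inside_def height_def by linarith

lemma width_le_height: "width R \<le> height R"
  by (simp add: width_def height_def)

lemma proper_width: "proper R \<longleftrightarrow> 0 < width R"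
  by (simp add: proper_def width_def)

lemma area_eq: "area R = xlen R * ylen R"
  by (simp add: area_def width_def height_def min_def max_def)

lemma proper_area: "proper R \<Longrightarrow> 0 < area R"
  by (simp add: proper_def area_eq)

lemma extent_long_dir [simp]:
  "extent (long_dir R) R = height R" "extent (across (long_dir R)) R = width R"
  by (auto simp: long_dir_def height_def width_def)

lemma width_extent: "width R = min (extent d R) (extent (across d) R)"
  by (cases d) (auto simp: width_def)

lemma height_extent: "height R = max (extent d R) (extent (across d) R)"
  by (cases d) (auto simp: height_def)

lemma area_extent: "area R = extent d R * extent (across d) R"
  by (cases d) (auto simp: area_eq)

lemma proper_extent: "proper R \<longleftrightarrow> 0 < extent d R \<and> 0 < extent (across d) R"
  by (cases d) (auto simp: proper_def)

lemma extent_cut [simp]: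
  "extent d (cut_off d l R) = l" "extent (across d) (cut_off d l R) = extent (across d) R"
  "extent d (cut_rest d l R) = extent d R - l"
  "extent (across d) (cut_rest d l R) = extent (across d) R"
  "extent d (cut_off (across d) l R) = extent d R" "extent (across d) (cut_off (across d) l R) = l"
  "extent d (cut_rest (across d) l R) = extent d R"
  "extent (across d) (cut_rest (across d) l R) = extent (across d) R - l"
  by (cases d; cases R; simp)+

lemma inside_cut:
  assumes "0 \<le> l" "l \<le> extent d R"
  shows "inside (cut_off d l R) R" "inside (cut_rest d l R) R"
  using assms by (cases d; cases R; simp add: inside_def)+

lemma apart_cut: "apart (cut_off d l R) (cut_rest d l R)"
  by (cases d; cases R; simp add: apart_def)

lemma region_mono: "inside R S \<Longrightarrow> region R \<subseteq> region S"
  unfolding inside_def region_def by (auto simp: cbox_Pair_eq)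

lemma apart_interior: "apart R S \<Longrightarrow> interior (region R) \<inter> interior (region S) = {}"
  unfolding apart_def region_def
  by (auto simp: cbox_Pair_eq interior_Times)

section \<open>The details\<close>

lemma wD_le_hD: "1 \<le> n \<Longrightarrow> wD F n \<le> hD F n"
  by (cases F) (auto simp: field_simps)

lemma hD_eq: "hD F n = 1 / real n"
  by (cases F) auto

lemma wD_bounds: 
  assumes "1 \<le> n"
  shows "wD F n \<le> 1 / real n" "1 / (real n + 1) \<le> wD F n"
  using assms by (cases F; simp add: field_simps)+

lemma wD_antimono: "1 \<le> m \<Longrightarrow> m \<le> n \<Longrightarrow> wD F n \<le> wD F m"
  by (cases F) (auto simp: field_simps)

lemma wD_pos: "1 \<le> n \<Longrightarrow> 0 < wD F n"
  by (cases F) auto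

lemma slack_pos: "1 \<le> n \<Longrightarrow> 0 < slack \<gamma> n"
  by (simp add: slack_def)

lemma slack_antimono: "0 < \<gamma> \<Longrightarrow> 1 \<le> m \<Longrightarrow> m \<le> n \<Longrightarrow> slack \<gamma> n \<le> slack \<gamma> m"
  unfolding slack_def by (intro powr_mono2') auto

lemma slack_le:
  assumes "1 < \<gamma>" "1 \<le> n"
  shows "slack \<gamma> n \<le> 1 / real n"
proof -
  have "real n powr (- \<gamma>) \<le> real n powr (-1)"
    using assms by (intro powr_mono) auto
  then show ?thesis
    using assms by (simp add: slack_def powr_minus_divide)
qed

lemma inverse_step:
  fixes x :: real
  assumes "0 < x"
  shows "1 / x - 1 / (x + 1) = 1 / (x * (x + 1))"
proof -
  have "x \<noteq> 0" "x + 1 \<noteq> 0" using assms by auto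
  then show ?thesis by (simp add: divide_simps)
qed

lemma hD_less:
  assumes "\<gamma> < 2" "1 \<le> n"
  shows "hD F n < wD F n + slack \<gamma> n"
proof -
  have "real n powr (-2) \<le> slack \<gamma> n"
    unfolding slack_def using assms by (intro powr_mono) auto
  moreover have "real n powr (-2) = 1 / (real n * real n)"
    using assms by (simp add: powr_minus_divide power2_eq_square)
  moreover have "1 / (real n * (real n + 1)) < 1 / (real n * real n)"
    using assms by (intro divide_strict_left_mono mult_strict_left_mono) auto
  moreover have "1 / real n = 1 / (real n + 1) + 1 / (real n * (real n + 1))"
    using inverse_step[of "real n"] assms by simp
  moreover have "0 < slack \<gamma> n" 
    using assms slack_pos by simp
  ultimately show ?thesis
    by (cases F) auto
qed

lemma detail_area_bounds:
  assumes "2 \<le> n"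
  shows "1 / real n - 1 / (real n + 1) \<le> wD F n * hD F n"
    and "wD F n * hD F n \<le> 1 / (real n - 1) - 1 / real n"
proof -
  have n: "0 < real n - 1" using assms by simp
  have "1 / (real n * (real n + 1)) \<le> 1 / (real n * real n)"
    "1 / (real n * real n) \<le> 1 / ((real n - 1) * real n)"
    using n by (intro divide_left_mono mult_left_mono mult_right_mono mult_pos_pos; simp)+
  moreover have "1 / real n - 1 / (real n + 1) = 1 / (real n * (real n + 1))"
    "1 / (real n - 1) - 1 / real n = 1 / ((real n - 1) * real n)"
    using inverse_step[of "real n"] inverse_step[OF n] n by simp_all
  moreover have "wD F n * hD F n = 1 / (real n * (real n + 1)) \<or> wD F n * hD F n = 1 / (real n * real n)"
    by (cases F) (simp_all add: mult.commute)
  ultimately show "1 / real n - 1 / (real n + 1) \<le> wD F n * hD F n"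
    and "wD F n * hD F n \<le> 1 / (real n - 1) - 1 / real n"
    by linarith+
qed

lemma S_com_bounds:
  assumes "2 \<le> t"
  shows "1 / real t \<le> S_com F t" "S_com F t \<le> 1 / (real t - 1)"
    and "S_com F t = wD F t * hD F t + S_com F (Suc t)"
    and "summable (\<lambda>k. wD F (t + k) * hD F (t + k))"
proof -
  let ?f = "\<lambda>k. wD F (t + k) * hD F (t + k)"
  have tend: "(\<lambda>k. 1 / (real t - c + real k)) \<longlonglongrightarrow> 0" for c
    by real_asymp
  have sums: "(\<lambda>k. 1 / (real t - c + real k) - 1 / (real t - c + real (Suc k))) sums (1 / (real t - c))" for c
    using telescope_sums'[OF tend[of c]] by simp
  have le: "1 / (real t + real k) - 1 / (real t + real (Suc k)) \<le> ?f k" for k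
    using detail_area_bounds(1)[of "t + k" F] assms by (simp add: add_ac)
  have ge: "?f k \<le> 1 / (real t - 1 + real k) - 1 / (real t - 1 + real (Suc k))" for k
  proof -
    have *: "real t - 1 + real k = real (t + k) - 1" "real t - 1 + real (Suc k) = real (t + k)"
      by auto
    show ?thesis
      unfolding * using detail_area_bounds(2)[of "t + k" F] assms by linarith
  qed
  show sm: "summable ?f"
  proof (rule summable_comparison_test'[OF sums_summable[OF sums[of 1]]])
    fix k
    have "0 \<le> ?f k" by (cases F) auto
    then show "norm (?f k) \<le> 1 / (real t - 1 + real k) - 1 / (real t - 1 + real (Suc k))"
      using ge[of k] by simp
  qed
  show "1 / real t \<le> S_com F t"
    unfolding S_com_def using sums_le[OF _ sums[of 0] summable_sums[OF sm]] le by simp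
  show "S_com F t \<le> 1 / (real t - 1)"
    unfolding S_com_def using sums_le[OF _ summable_sums[OF sm] sums[of 1]] ge by simp
  show "S_com F t = wD F t * hD F t + S_com F (Suc t)"
    unfolding S_com_def using suminf_split_head[OF sm] by simp
qed

section \<open>Layouts\<close>

locale layout =
  fixes F :: family and n0 t :: nat and s :: state
  assumes finite_boxes: "finite (boxes s)"
    and proper_lrp: "proper (lrp s)"
    and lrp_inside: "inside (lrp s) (sheet F n0)"
    and boxes_shape: "B \<in> boxes s \<Longrightarrow>
      proper (shape B) \<and> inside (shape B) (sheet F n0) \<and> apart (shape B) (lrp s)"
    and boxes_apart: "B \<in> boxes s \<Longrightarrow> B' \<in> boxes s \<Longrightarrow> B \<noteq> B' \<Longrightarrow> apart (shape B) (shape B')"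
    and placed_dom: "placed s m \<noteq> None \<longleftrightarrow> n0 \<le> m \<and> m < t"
    and placed_shape: "placed s m = Some R \<Longrightarrow> width R = wD F m \<and> height R = hD F m \<and>
      inside R (sheet F n0) \<and> apart R (lrp s) \<and> (\<forall>B\<in>boxes s. apart R (shape B))"
    and placed_apart: "placed s m = Some R \<Longrightarrow> placed s m' = Some R' \<Longrightarrow> m \<noteq> m' \<Longrightarrow> apart R R'"
    and total_area: "area (lrp s) + (\<Sum>B\<in>boxes s. area (shape B)) = S_com F t"

lemmas layoutD = layout.finite_boxes layout.proper_lrp layout.lrp_inside layout.boxes_shape
  layout.boxes_apart layout.placed_dom layout.placed_shape layout.placed_apart layout.total_area

definition new_endpoint :: "family \<Rightarrow> nat \<Rightarrow> state \<Rightarrow> box" where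
  "new_endpoint F n s = Box (endpoint_kind (row_kind s))
     (cut_rest (row_dir s) (hD F n) (shape (the (active s))))"

definition new_normal :: "family \<Rightarrow> nat \<Rightarrow> state \<Rightarrow> box" where
  "new_normal F n s = Box (normal_kind (row_kind s)) (cut_rest (across (row_dir s)) (wD F n)
     (cut_off (row_dir s) (hD F n) (shape (the (active s)))))"

definition new_place :: "family \<Rightarrow> nat \<Rightarrow> state \<Rightarrow> rect" where
  "new_place F n s = cut_off (across (row_dir s)) (wD F n)
     (cut_off (row_dir s) (hD F n) (shape (the (active s))))"

lemma step5_eq:
  "step5 F n s = s\<lparr>boxes := insert (new_endpoint F n s) (insert (new_normal F n s)
     (boxes s - {the (active s)})), active := Some (new_endpoint F n s),
     placed := (placed s)(n \<mapsto> new_place F n s)\<rparr>"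
  by (simp add: step5_def Let_def new_endpoint_def new_normal_def new_place_def insert_commute)

lemma step5_simps [simp]:
  "lrp (step5 F n s) = lrp s"
  "boxes (step5 F n s) = insert (new_endpoint F n s) (insert (new_normal F n s)
     (boxes s - {the (active s)}))"
  "active (step5 F n s) = Some (new_endpoint F n s)"
  "row_dir (step5 F n s) = row_dir s" "row_kind (step5 F n s) = row_kind s"
  "row_start (step5 F n s) = row_start s"
  "placed (step5 F n s) = (placed s)(n \<mapsto> new_place F n s)"
  by (simp_all add: step5_eq)

lemma start_row_simps [simp]:
  "lrp (start_row n B s) = lrp s" "boxes (start_row n B s) = boxes s"
  "active (start_row n B s) = Some B" "row_dir (start_row n B s) = long_dir (shape B)"
  "row_kind (start_row n B s) = kind B" "row_start (start_row n B s) = n"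
  "placed (start_row n B s) = placed s"
  by (simp_all add: start_row_def)

definition along :: "state \<Rightarrow> box \<Rightarrow> real" where
  "along s B = extent (row_dir s) (shape B)"

definition breadth :: "state \<Rightarrow> box \<Rightarrow> real" where
  "breadth s B = extent (across (row_dir s)) (shape B)"

lemma w_along_breadth: "w B = min (along s B) (breadth s B)"
  unfolding along_def breadth_def by (rule width_extent)

lemma h_along_breadth: "h B = max (along s B) (breadth s B)"
  unfolding along_def breadth_def by (rule height_extent)

lemma new_boxes_extents:
  assumes "active s = Some A"
  shows "along s (new_endpoint F n s) = along s A - hD F n"
    and "breadth s (new_endpoint F n s) = breadth s A"
    and "along s (new_normal F n s) = hD F n"
    and "breadth s (new_normal F n s) = breadth s A - wD F n"
  using assms by (simp_all add: along_def breadth_def new_endpoint_def new_normal_def)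

lemma new_boxes_inside:
  assumes "active s = Some A" "1 \<le> n" "hD F n < along s A" "wD F n < breadth s A"
  shows "inside (shape (new_endpoint F n s)) (shape A)"
    and "inside (shape (new_normal F n s)) (shape A)"
    and "inside (new_place F n s) (shape A)"
    and "apart (shape (new_endpoint F n s)) (shape (new_normal F n s))"
    and "apart (new_place F n s) (shape (new_endpoint F n s))"
    and "apart (new_place F n s) (shape (new_normal F n s))"
    and "proper (shape (new_endpoint F n s))" "proper (shape (new_normal F n s))"
    and "width (new_place F n s) = wD F n" "height (new_place F n s) = hD F n"
    and "area (shape A) = wD F n * hD F n + area (shape (new_endpoint F n s)) + area (shape (new_normal F n s))"
proof -
  let ?d = "row_dir s" and ?R = "shape A"
  let ?p = "cut_off ?d (hD F n) ?R"
  have pos: "0 < wD F n" "wD F n \<le> hD F n" using wD_pos wD_le_hD assms(2) by auto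
  have al: "hD F n < extent ?d ?R" and br: "wD F n < extent (across ?d) ?R"
    using assms(3,4) by (auto simp: along_def breadth_def)
  note defs = new_endpoint_def new_normal_def new_place_def assms(1)
  have p: "inside ?p ?R" "inside (cut_rest ?d (hD F n) ?R) ?R"
    using al pos by (auto intro!: inside_cut)
  have q: "inside (cut_off (across ?d) (wD F n) ?p) ?p" "inside (cut_rest (across ?d) (wD F n) ?p) ?p"
    using br pos by (auto intro!: inside_cut)
  have a: "apart ?p (cut_rest ?d (hD F n) ?R)"
    by (rule apart_cut)
  show "inside (shape (new_endpoint F n s)) (shape A)"
    "inside (shape (new_normal F n s)) (shape A)"
    "inside (new_place F n s) (shape A)"
    using p q inside_trans by (auto simp: defs)
  show "apart (shape (new_endpoint F n s)) (shape (new_normal F n s))"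
    "apart (new_place F n s) (shape (new_endpoint F n s))"
    using apart_inside[OF a q(1) inside_refl] apart_sym[OF apart_inside[OF a q(2) inside_refl]]
    by (auto simp: defs)
  show "apart (new_place F n s) (shape (new_normal F n s))"
    using apart_cut by (auto simp: defs)
  show "proper (shape (new_endpoint F n s))" "proper (shape (new_normal F n s))"
    using al br pos by (auto simp: defs proper_extent[of _ ?d])
  show "width (new_place F n s) = wD F n" "height (new_place F n s) = hD F n"
    using al br pos by (auto simp: defs width_extent[of _ ?d] height_extent[of _ ?d])
  show "area (shape A) = wD F n * hD F n + area (shape (new_endpoint F n s)) + area (shape (new_normal F n s))"
    by (simp add: defs area_extent[of _ ?d] algebra_simps)
qed

lemma layout_not_in:
  assumes "layout F n0 t s" "A \<in> boxes s" "inside (shape B) (shape A)" "proper (shape B)"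
  shows "B \<notin> boxes s - {A}"
proof
  assume B: "B \<in> boxes s - {A}"
  then have "apart (shape B) (shape A)"
    using layout.boxes_apart[OF assms(1)] assms(2) by auto
  then have "apart (shape B) (shape B)"
    using apart_inside[OF _ inside_refl assms(3)] by blast
  then show False using apart_irrefl assms(4) by blast
qed

lemma layout_step5:
  assumes lay: "layout F n0 t s" and A: "active s = Some A" "A \<in> boxes s"
    and t: "n0 \<le> t" "2 \<le> t" and fit: "hD F t < along s A" "wD F t < breadth s A"
  shows "new_endpoint F t s \<notin> boxes s - {A}" "new_normal F t s \<notin> boxes s - {A}"
    "new_endpoint F t s \<noteq> new_normal F t s" "layout F n0 (Suc t) (step5 F t s)"
proof -
  let ?E = "new_endpoint F t s" and ?M = "new_normal F t s" and ?P = "new_place F t s"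
  have "1 \<le> t" using t by simp
  note new = new_boxes_inside[OF A(1) \<open>1 \<le> t\<close> fit]
  show E: "?E \<notin> boxes s - {A}" and M: "?M \<notin> boxes s - {A}"
    using layout_not_in[OF lay A(2)] new by blast+
  show EM: "?E \<noteq> ?M"
    using new(4,7) apart_irrefl by metis
  have fin: "finite (boxes s)" and lrp: "proper (lrp s)" "inside (lrp s) (sheet F n0)"
    and bx: "\<And>B. B \<in> boxes s \<Longrightarrow> proper (shape B) \<and> inside (shape B) (sheet F n0) \<and> apart (shape B) (lrp s)"
    and bb: "\<And>B B'. B \<in> boxes s \<Longrightarrow> B' \<in> boxes s \<Longrightarrow> B \<noteq> B' \<Longrightarrow> apart (shape B) (shape B')"
    and dom: "\<And>m. placed s m \<noteq> None \<longleftrightarrow> n0 \<le> m \<and> m < t"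
    and pl: "\<And>m R. placed s m = Some R \<Longrightarrow> width R = wD F m \<and> height R = hD F m \<and>
        inside R (sheet F n0) \<and> apart R (lrp s) \<and> (\<forall>B\<in>boxes s. apart R (shape B))"
    and pp: "\<And>m m' R R'. placed s m = Some R \<Longrightarrow> placed s m' = Some R' \<Longrightarrow> m \<noteq> m' \<Longrightarrow> apart R R'"
    and ar: "area (lrp s) + (\<Sum>B\<in>boxes s. area (shape B)) = S_com F t"
    by (fact layoutD[OF lay])+
  have sub: "proper (shape B) \<and> inside (shape B) (sheet F n0) \<and> apart (shape B) (lrp s)"
    if "B \<in> {?E, ?M}" for B
    using that new(1,2,7,8) bx[OF A(2)] inside_trans apart_inside_left by blast
  have subb: "apart (shape B) (shape B')" if "B \<in> {?E, ?M}" "B' \<in> boxes s - {A}" for B B'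
    using that new(1,2) bb[OF A(2), of B'] apart_inside_left by blast
  have subP: "apart R (shape B)" if "placed s m = Some R" "B \<in> {?E, ?M}" for m R B
    using that pl[OF that(1)] A(2) new(1,2) apart_inside[OF _ inside_refl] by blast
  have Pb: "apart ?P (shape B)" if "B \<in> boxes s - {A}" for B
    using that bb[OF A(2), of B] new(3) apart_inside_left by blast
  have Pp: "apart ?P R" if "placed s m = Some R" for m R
    using pl[OF that] A(2) new(3) apart_inside_left apart_sym by blast
  have Pl: "inside ?P (sheet F n0)" "apart ?P (lrp s)"
    using bx[OF A(2)] new(3) inside_trans apart_inside_left by blast+
  have "(\<Sum>B\<in>boxes (step5 F t s). area (shape B)) = area (shape ?E) + area (shape ?M)
      + (\<Sum>B\<in>boxes s - {A}. area (shape B))"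
    using E M EM fin A by simp
  moreover have "(\<Sum>B\<in>boxes s. area (shape B)) = area (shape A) + (\<Sum>B\<in>boxes s - {A}. area (shape B))"
    using fin A by (simp add: sum.remove)
  ultimately have ar': "area (lrp s) + (\<Sum>B\<in>boxes (step5 F t s). area (shape B)) = S_com F (Suc t)"
    using ar new(11) S_com_bounds(3)[OF t(2), of F] by linarith
  let ?s = "step5 F t s"
  have 1: "finite (boxes ?s) \<and> proper (lrp ?s) \<and> inside (lrp ?s) (sheet F n0)"
    using fin lrp by simp
  have 2: "\<forall>B\<in>boxes ?s. proper (shape B) \<and> inside (shape B) (sheet F n0) \<and> apart (shape B) (lrp ?s)"
    using sub bx by auto
  have 3: "\<forall>B\<in>boxes ?s. \<forall>B'\<in>boxes ?s. B \<noteq> B' \<longrightarrow> apart (shape B) (shape B')"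
  proof (intro ballI impI)
    fix B B' assume B: "B \<in> boxes ?s" "B' \<in> boxes ?s" "B \<noteq> B'"
    then consider "B \<in> {?E, ?M}" "B' \<in> {?E, ?M}" | "B \<in> {?E, ?M}" "B' \<in> boxes s - {A}"
      | "B \<in> boxes s - {A}" "B' \<in> {?E, ?M}" | "B \<in> boxes s" "B' \<in> boxes s"
      using A by auto
    then show "apart (shape B) (shape B')"
    proof cases
      case 1
      then show ?thesis using B(3) new(4) apart_sym by auto
    next
      case 2
      then show ?thesis using subb by blast
    next
      case 3
      then show ?thesis using subb apart_sym by blast
    next
      case 4
      then show ?thesis using bb B(3) by blast
    qed
  qed
  have 4: "\<forall>m. placed ?s m \<noteq> None \<longleftrightarrow> n0 \<le> m \<and> m < Suc t"
    using dom t by (auto simp: less_Suc_eq)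
  have 5: "\<forall>m R. placed ?s m = Some R \<longrightarrow> width R = wD F m \<and> height R = hD F m \<and>
        inside R (sheet F n0) \<and> apart R (lrp ?s) \<and> (\<forall>B\<in>boxes ?s. apart R (shape B))"
    using pl subP Pb Pl new(5,6,9,10) A by (auto split: if_splits)
  have 6: "\<forall>m m' R R'. placed ?s m = Some R \<longrightarrow> placed ?s m' = Some R' \<longrightarrow> m \<noteq> m' \<longrightarrow> apart R R'"
    using pp Pp apart_sym by (auto split: if_splits)
  show "layout F n0 (Suc t) ?s"
    unfolding layout_def using 1 2 3 4 5 6 ar' by simp
qed

lemma layout_start_row [simp]: "layout F n0 t (start_row n B s) = layout F n0 t s"
  by (simp add: layout_def)

lemma layout_stripe:
  assumes lay: "layout F n0 t s" and l: "0 < l" "l < height (lrp s)"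
    and d: "d = long_dir (lrp s)" and B: "B = Box Stripe (cut_off d l (lrp s))"
  shows "B \<notin> boxes s"
    and "layout F n0 t (s\<lparr>lrp := cut_rest d l (lrp s), boxes := insert B (boxes s)\<rparr>)"
proof -
  let ?L = "cut_rest d l (lrp s)"
  have fin: "finite (boxes s)" and lrp: "proper (lrp s)" "inside (lrp s) (sheet F n0)"
    and bx: "\<And>B. B \<in> boxes s \<Longrightarrow> proper (shape B) \<and> inside (shape B) (sheet F n0) \<and> apart (shape B) (lrp s)"
    and ar: "area (lrp s) + (\<Sum>B\<in>boxes s. area (shape B)) = S_com F t"
    and pl: "\<And>m R. placed s m = Some R \<Longrightarrow> apart R (lrp s)"
    using layoutD[OF lay] by simp_all
  have ins: "inside (shape B) (lrp s)" "inside ?L (lrp s)"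
    using l d B by (auto intro!: inside_cut)
  have ap: "apart (shape B) ?L" using B apart_cut by simp
  have prp: "proper (shape B)" "proper ?L"
    using l d B lrp by (auto simp: proper_extent[of _ d])
  show notin: "B \<notin> boxes s"
    using bx apart_irrefl[OF prp(1)] apart_inside[OF _ inside_refl ins(1)] by blast
  have "area (lrp s) = area (shape B) + area ?L"
    using B by (simp add: area_extent[of _ d] algebra_simps)
  then have ar': "area ?L + (\<Sum>B\<in>insert B (boxes s). area (shape B)) = S_com F t"
    using ar notin fin by simp
  have *: "apart (shape B') ?L" "apart (shape B) (shape B')" "apart (shape B') (shape B)" if "B' \<in> boxes s" for B'
    using bx[OF that] ins apart_inside[OF _ inside_refl] apart_sym by blast+
  have **: "apart R ?L" "apart R (shape B)" if "placed s m = Some R" for m R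
    using pl[OF that] ins apart_inside[OF _ inside_refl] by blast+
  have ***: "inside (shape B) (sheet F n0)" "inside ?L (sheet F n0)"
    using ins lrp(2) inside_trans by blast+
  show "layout F n0 t (s\<lparr>lrp := ?L, boxes := insert B (boxes s)\<rparr>)"
    using layoutD[OF lay] fin ar' prp ap * ** *** unfolding layout_def by auto
qed

section \<open>Power sums\<close>

lemma powr_tail_step:
  assumes "1 < m" "0 < \<gamma>"
  shows "m powr (- (1 + \<gamma>)) \<le> ((m - 1) powr (- \<gamma>) - m powr (- \<gamma>)) / (\<gamma> :: real)"
proof -
  have "\<exists>z>m - 1. z < m \<and> m powr (- \<gamma>) - (m - 1) powr (- \<gamma>) = (m - (m - 1)) * (- \<gamma> * z powr (- \<gamma> - 1))"
    using assms by (intro MVT2) (auto intro!: derivative_eq_intros)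
  then obtain z where z: "m - 1 < z" "z < m"
    "m powr (- \<gamma>) - (m - 1) powr (- \<gamma>) = - \<gamma> * z powr (- \<gamma> - 1)"
    by auto
  have "m powr (- \<gamma> - 1) \<le> z powr (- \<gamma> - 1)"
    using z assms by (intro powr_mono2') auto
  moreover have "z powr (- \<gamma> - 1) = ((m - 1) powr (- \<gamma>) - m powr (- \<gamma>)) / \<gamma>"
    using z(3) assms by (simp add: field_simps)
  moreover have "- (1 + \<gamma>) = - \<gamma> - 1"
    by simp
  ultimately show ?thesis
    by metis
qed

lemma powr_tail_sum:
  fixes x \<gamma> :: real and M :: "nat set"
  assumes "finite M" "1 < x" "0 < \<gamma>" "\<And>m. m \<in> M \<Longrightarrow> x \<le> real m"
  shows "(\<Sum>m\<in>M. real m powr (- (1 + \<gamma>))) \<le> (x - 1) powr (- \<gamma>) / \<gamma>"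
proof -
  define a where "a = nat \<lceil>x\<rceil>"
  have a: "x \<le> real a" unfolding a_def using assms by linarith
  obtain b where b: "M \<subseteq> {..<b}" using finite_nat_iff_bounded assms(1) by blast
  have M: "M \<subseteq> {a..<max a b}"
    using b assms(4) unfolding a_def by (auto simp: nat_le_iff ceiling_le_iff)
  let ?f = "\<lambda>i. - ((real i - 1) powr (- \<gamma>) / \<gamma>)"
  have "(\<Sum>m\<in>M. real m powr (- (1 + \<gamma>))) \<le> (\<Sum>m=a..<max a b. real m powr (- (1 + \<gamma>)))"
    using M by (intro sum_mono2) auto
  also have "\<dots> \<le> (\<Sum>m=a..<max a b. ?f (Suc m) - ?f m)"
  proof (rule sum_mono)
    fix m assume "m \<in> {a..<max a b}"
    then have "1 < real m" using a assms(2) by auto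
    then show "real m powr (- (1 + \<gamma>)) \<le> ?f (Suc m) - ?f m"
      using powr_tail_step[of "real m" \<gamma>] assms(3) by (simp add: diff_divide_distrib)
  qed
  also have "\<dots> = ?f (max a b) - ?f a"
    by (rule sum_Suc_diff') simp
  also have "\<dots> \<le> (real a - 1) powr (- \<gamma>) / \<gamma>"
    using assms(3) by simp
  also have "\<dots> \<le> (x - 1) powr (- \<gamma>) / \<gamma>"
    using a assms by (intro divide_right_mono powr_mono2') auto
  finally show ?thesis .
qed

section \<open>The census of boxes\<close>

definition normals :: "box set \<Rightarrow> box set" where
  "normals X = {B\<in>X. kind B \<in> {Normal1, Normal2}}"

definition of_kind :: "kind \<Rightarrow> box set \<Rightarrow> box set" where
  "of_kind k X = {B\<in>X. kind B = k}"

lemma normals_insert [simp]: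
  "normals (insert B X) = (if kind B \<in> {Normal1, Normal2} then insert B (normals X) else normals X)"
  by (auto simp: normals_def)

lemma of_kind_insert [simp]:
  "of_kind k (insert B X) = (if kind B = k then insert B (of_kind k X) else of_kind k X)"
  by (auto simp: of_kind_def)

lemma normals_Diff [simp]:
  "normals (X - {B}) = normals X - {B}"
  by (auto simp: normals_def)

lemma of_kind_Diff [simp]:
  "of_kind k (X - {B}) = of_kind k X - {B}"
  by (auto simp: of_kind_def)

lemma finite_normals [simp]: "finite X \<Longrightarrow> finite (normals X)"
  by (simp add: normals_def)

lemma finite_of_kind [simp]: "finite X \<Longrightarrow> finite (of_kind k X)"
  by (simp add: of_kind_def)

text \<open>The parameter \<open>c\<close> is the lower bound to be proved for the share of the LRP in the remaining
  area. The three summands of \<open>budget\<close> bound the total areas of the normal boxes, of the endpoints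
  of the first kind and of those of the second kind at a critical moment \<open>t\<close>; \<open>narrow\<close> excludes that
  the normal box created with \<open>D\<^sub>t\<close> is longer across the row than along it.\<close>

locale slack_pack =
  fixes F :: family and \<gamma> :: real and pick :: choice and n0 :: nat and \<sigma> c K :: real
  assumes gamma: "1 < \<gamma>" "\<gamma> < 2"
    and pick: "max_width_choice pick"
    and sigma: "0 \<le> \<sigma>" "\<sigma> \<le> 1"
    and c: "0 < c" "c \<le> 1"
    and n0: "16 / c \<le> real n0"
    and normal_width: "\<And>t B. B \<in> B_norm F \<gamma> pick n0 t \<Longrightarrow> w B \<le> (1 + \<sigma>) * h B powr \<gamma>"
    and K: "0 \<le> K"
    and endpoint_ratio: "\<And>t0 t. is_t0 F \<gamma> pick n0 t0 \<Longrightarrow> t \<in> T_crit F \<gamma> pick n0 \<Longrightarrow> t0 < t \<Longrightarrow>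
      1 / real (card (B_ep2 F \<gamma> pick n0 t)) * (\<Sum>B\<in>B_ep2 F \<gamma> pick n0 t. h B / w B) \<le> K * ln (real t)"
    and narrow: "\<And>t. n0 \<le> t \<Longrightarrow> 2 * (8 / (c * real t)) powr \<gamma> < 1 / real t"
    and tail_start: "\<And>t. n0 \<le> t \<Longrightarrow> (1 / real t + slack \<gamma> t) powr (1 / \<gamma>) < 1"
    and budget: "\<And>t. n0 \<le> t \<Longrightarrow>
      (1 + \<sigma>) * ((1 / (1 / real t + slack \<gamma> t) powr (1 / \<gamma>) - 1) powr (- \<gamma>) / \<gamma>) +
      (1 / real t + slack \<gamma> t) * (16 * sqrt (1 / (real n0 - 1))) +
      (1 / real t + slack \<gamma> t)\<^sup>2 * ((4 * real t) powr (1 / \<gamma>) * (K * ln (real t))) < (1 - c) * (1 / real t)"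
begin

lemma n0_16: "16 \<le> n0"
proof -
  have "16 \<le> 16 / c" using c by (simp add: field_simps)
  then show ?thesis using n0 by linarith
qed

text \<open>Normal boxes chosen up to the moment \<open>t\<close> are wider than \<open>wD F t\<close>, hence of height at least
  \<open>tall t\<close>. Their heights are distinct reciprocals, so there are few of them, and every endpoint of
  the second kind descends from one of them.\<close>

definition tall :: "nat \<Rightarrow> real" where
  "tall t = (1 / (4 * real t)) powr (1 / \<gamma>)"

text \<open>\<open>p\<close> and \<open>q\<close> reserve room for the endpoint of the current row: \<open>p\<close> is its contribution to the
  number of endpoints of the second kind, \<open>q\<close> a bound for its contribution to the total height of
  the endpoints of the first kind, both taken at the end of the row. The potential \<open>sqrt L\<close>, where \<open>L\<close> is
  the area of the LRP, pays for the endpoints of the first kind.\<close>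

definition census :: "nat \<Rightarrow> box set \<Rightarrow> nat \<Rightarrow> real \<Rightarrow> real \<Rightarrow> bool" where
  "census t X p q L \<longleftrightarrow>
     (\<forall>B\<in>X. kind B \<noteq> Stripe) \<and>
     (\<forall>B\<in>normals X. (\<exists>m\<in>{n0..<t}. h B = 1 / real m) \<and> h B powr \<gamma> \<le> w B \<and>
        w B \<le> (1 + \<sigma>) * h B powr \<gamma>) \<and>
     inj_on h (normals X) \<and>
     (\<forall>x. 0 < x \<longrightarrow> x \<le> tall t \<longrightarrow> card {B\<in>normals X. x \<le> h B} + card (of_kind Endpoint2 X) + p
        \<le> card {m\<in>{n0..<t}. x \<le> 1 / real m}) \<and>
     (\<Sum>B\<in>of_kind Endpoint1 X. h B) + q \<le> 16 * (sqrt (S_com F n0) - sqrt L) \<and>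
     (of_kind Endpoint2 X \<noteq> {} \<or> 0 < p \<longrightarrow> (\<exists>t0\<le>t. chooses_normal F \<gamma> pick n0 t0))"

lemma censusD:
  assumes "census t X p q L"
  shows "\<forall>B\<in>X. kind B \<noteq> Stripe"
    and "\<forall>B\<in>normals X. (\<exists>m\<in>{n0..<t}. h B = 1 / real m) \<and> h B powr \<gamma> \<le> w B \<and>
        w B \<le> (1 + \<sigma>) * h B powr \<gamma>"
    and "inj_on h (normals X)"
    and "\<forall>x. 0 < x \<longrightarrow> x \<le> tall t \<longrightarrow> card {B\<in>normals X. x \<le> h B} + card (of_kind Endpoint2 X) + p
        \<le> card {m\<in>{n0..<t}. x \<le> 1 / real m}"
    and "(\<Sum>B\<in>of_kind Endpoint1 X. h B) + q \<le> 16 * (sqrt (S_com F n0) - sqrt L)"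
    and "of_kind Endpoint2 X \<noteq> {} \<or> 0 < p \<longrightarrow> (\<exists>t0\<le>t. chooses_normal F \<gamma> pick n0 t0)"
  using assms unfolding census_def by blast+

lemma tall_antimono: "1 \<le> m \<Longrightarrow> m \<le> n \<Longrightarrow> tall n \<le> tall m"
  unfolding tall_def using gamma by (intro powr_mono2 divide_left_mono) auto

lemma census_empty: "L \<le> S_com F n0 \<Longrightarrow> census t {} 0 0 L"
  by (simp add: census_def normals_def of_kind_def)

lemma census_mono: "census t X p q L \<Longrightarrow> q' \<le> q \<Longrightarrow> census t X p q' L"
  unfolding census_def by auto

lemma census_insert_normal:
  assumes "census t X p q L" "finite X" "n0 \<le> t" "M \<notin> X" "kind M \<in> {Normal1, Normal2}"
    "h M = 1 / real t" "h M powr \<gamma> \<le> w M" "w M \<le> (1 + \<sigma>) * h M powr \<gamma>"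
  shows "census (Suc t) (insert M X) p q L"
proof -
  have t: "1 \<le> t" using assms(3) n0_16 by simp
  have hX: "h B \<noteq> 1 / real t" if "B \<in> normals X" for B
  proof -
    obtain m where "n0 \<le> m" "m < t" "h B = 1 / real m"
      using censusD(2)[OF assms(1)] \<open>B \<in> normals X\<close> by auto
    then show ?thesis using n0_16 by simp
  qed
  have "card {B\<in>normals (insert M X). x \<le> h B} + card (of_kind Endpoint2 (insert M X)) + p
      \<le> card {m\<in>{n0..<Suc t}. x \<le> 1 / real m}" if x: "0 < x" "x \<le> tall (Suc t)" for x
  proof -
    have "x \<le> tall t" using x(2) tall_antimono[of t "Suc t"] t by simp
    then have le: "card {B\<in>normals X. x \<le> h B} + card (of_kind Endpoint2 X) + p
        \<le> card {m\<in>{n0..<t}. x \<le> 1 / real m}"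
      using censusD(4)[OF assms(1)] x(1) by blast
    have "M \<notin> normals X" using assms(4) by (simp add: normals_def)
    then have "card {B\<in>normals (insert M X). x \<le> h B} =
        card {B\<in>normals X. x \<le> h B} + (if x \<le> 1 / real t then 1 else 0)"
    proof -
      have "{B\<in>normals (insert M X). x \<le> h B} =
          (if x \<le> 1 / real t then insert M {B\<in>normals X. x \<le> h B} else {B\<in>normals X. x \<le> h B})"
        using assms(5,6) by auto
      then show ?thesis using \<open>M \<notin> normals X\<close> assms(2) by simp
    qed
    moreover have "card {m\<in>{n0..<Suc t}. x \<le> 1 / real m} =
        card {m\<in>{n0..<t}. x \<le> 1 / real m} + (if x \<le> 1 / real t then 1 else 0)"
    proof -
      have "{m\<in>{n0..<Suc t}. x \<le> 1 / real m} =
          (if x \<le> 1 / real t then insert t {m\<in>{n0..<t}. x \<le> 1 / real m} else {m\<in>{n0..<t}. x \<le> 1 / real m})"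
        using assms(3) by (auto simp: less_Suc_eq)
      then show ?thesis by simp
    qed
    moreover have "of_kind Endpoint2 (insert M X) = of_kind Endpoint2 X"
      using assms(5) by auto
    ultimately show ?thesis using le by simp
  qed
  moreover have "inj_on h (normals (insert M X))"
  proof -
    have "h M \<notin> h ` normals X" using hX assms(6) by (metis imageE)
    then show ?thesis using censusD(3)[OF assms(1)] assms(5) by auto
  qed
  moreover have "of_kind Endpoint1 (insert M X) = of_kind Endpoint1 X"
    "of_kind Endpoint2 (insert M X) = of_kind Endpoint2 X"
    using assms(5) by auto
  moreover have "\<forall>B\<in>normals (insert M X). (\<exists>m\<in>{n0..<Suc t}. h B = 1 / real m) \<and> h B powr \<gamma> \<le> w B \<and>
        w B \<le> (1 + \<sigma>) * h B powr \<gamma>"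
  proof
    fix B assume "B \<in> normals (insert M X)"
    then consider "B = M" | "B \<in> normals X" using assms(5) by auto
    then show "(\<exists>m\<in>{n0..<Suc t}. h B = 1 / real m) \<and> h B powr \<gamma> \<le> w B \<and>
        w B \<le> (1 + \<sigma>) * h B powr \<gamma>"
    proof cases
      case 1
      then show ?thesis using assms(3,6,7,8) by auto
    next
      case 2
      then obtain m where "m \<in> {n0..<t}" "h B = 1 / real m"
        using censusD(2)[OF assms(1)] by blast
      then have "\<exists>m\<in>{n0..<Suc t}. h B = 1 / real m" by (intro bexI[of _ m]) auto
      then show ?thesis using 2 censusD(2)[OF assms(1)] by blast
    qed
  qed
  moreover have "\<forall>B\<in>insert M X. kind B \<noteq> Stripe"
    using censusD(1)[OF assms(1)] assms(5) by auto
  moreover have "of_kind Endpoint2 X \<noteq> {} \<or> 0 < p \<longrightarrow> (\<exists>t0\<le>Suc t. chooses_normal F \<gamma> pick n0 t0)"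
    "(\<Sum>B\<in>of_kind Endpoint1 X. h B) + q \<le> 16 * (sqrt (S_com F n0) - sqrt L)"
    using censusD(5,6)[OF assms(1)] le_SucI by blast+
  ultimately show ?thesis
    unfolding census_def by simp
qed

lemma census_end_row:
  assumes "census t X (if k = Endpoint2 then 1 else 0) (if k = Endpoint1 then v else 0) L"
    "finite X" "E \<notin> X" "kind E = k" "k \<in> {Endpoint1, Endpoint2}" "k = Endpoint1 \<Longrightarrow> h E \<le> v"
  shows "census t (insert E X) 0 0 L"
proof -
  have [simp]: "E \<notin> of_kind k X" for k using assms(3) by (simp add: of_kind_def)
  have [simp]: "E \<notin> normals X" using assms(3) by (simp add: normals_def)
  have n: "normals (insert E X) = normals X" using assms(4,5) by auto
  have "\<forall>B\<in>insert E X. kind B \<noteq> Stripe"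
    using censusD(1)[OF assms(1)] assms(4,5) by auto
  moreover have "card {B\<in>normals (insert E X). x \<le> h B} + card (of_kind Endpoint2 (insert E X)) + 0
      = card {B\<in>normals X. x \<le> h B} + card (of_kind Endpoint2 X) + (if k = Endpoint2 then 1 else 0)" for x
    unfolding n using assms(2,4,5) by simp
  moreover have "(\<Sum>B\<in>of_kind Endpoint1 (insert E X). h B) + 0
      \<le> (\<Sum>B\<in>of_kind Endpoint1 X. h B) + (if k = Endpoint1 then v else 0)"
    using assms(2,4,5,6) by auto
  moreover have "of_kind Endpoint2 (insert E X) \<noteq> {} \<or> 0 < (0::nat) \<longrightarrow>
      of_kind Endpoint2 X \<noteq> {} \<or> 0 < (if k = Endpoint2 then 1 else 0 :: nat)"
    using assms(4,5) by auto
  ultimately show ?thesis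
    unfolding census_def n using censusD[OF assms(1)] by (intro conjI) (fastforce | linarith | metis)+
qed

lemma census_remove:
  assumes "census t X 0 0 L" "finite X" "B \<in> X"
    "kind B \<in> {Normal1, Normal2} \<Longrightarrow> tall t \<le> h B \<and> chooses_normal F \<gamma> pick n0 t"
  shows "census t (X - {B}) (if endpoint_kind (kind B) = Endpoint2 then 1 else 0)
     (if endpoint_kind (kind B) = Endpoint1 then h B else 0) L"
proof -
  have ns: "kind B \<noteq> Stripe" using censusD(1)[OF assms(1)] assms(3) by blast
  have card: "card {C\<in>normals (X - {B}). x \<le> h C} + card (of_kind Endpoint2 (X - {B})) +
      (if endpoint_kind (kind B) = Endpoint2 then 1 else 0)
      \<le> card {m\<in>{n0..<t}. x \<le> 1 / real m}" if x: "0 < x" "x \<le> tall t" for x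
  proof -
    have le: "card {C\<in>normals X. x \<le> h C} + card (of_kind Endpoint2 X)
        \<le> card {m\<in>{n0..<t}. x \<le> 1 / real m}"
      using censusD(4)[OF assms(1)] x by auto
    have fin: "finite {C\<in>normals X. x \<le> h C}" "finite (of_kind Endpoint2 X)"
      using assms(2) by auto
    have e: "{C\<in>normals (X - {B}). x \<le> h C} = {C\<in>normals X. x \<le> h C} - {B}"
      by auto
    show ?thesis
    proof (cases "endpoint_kind (kind B) = Endpoint2")
      case True
      then consider "B \<in> {C\<in>normals X. x \<le> h C}" "B \<notin> of_kind Endpoint2 X"
        | "B \<notin> {C\<in>normals X. x \<le> h C}" "B \<in> of_kind Endpoint2 X"
        using assms(3,4) x(2) by (cases "kind B") (auto simp: endpoint_kind_def normals_def of_kind_def)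
      then show ?thesis
      proof cases
        case 1
        then have "card {C\<in>normals X. x \<le> h C} = Suc (card ({C\<in>normals X. x \<le> h C} - {B}))"
          using fin by (metis card_Suc_Diff1)
        then show ?thesis using le 1 True unfolding e by simp
      next
        case 2
        then have "card (of_kind Endpoint2 X) = Suc (card (of_kind Endpoint2 X - {B}))"
          using fin by (metis card_Suc_Diff1)
        then show ?thesis using le 2(1) True unfolding e by simp
      qed
    next
      case False
      then show ?thesis
        using le card_mono[OF fin(1), of "{C\<in>normals X. x \<le> h C} - {B}"]
          card_mono[OF fin(2), of "of_kind Endpoint2 X - {B}"] unfolding e by auto
    qed
  qed
  have "(\<Sum>C\<in>of_kind Endpoint1 (X - {B}). h C) + (if endpoint_kind (kind B) = Endpoint1 then h B else 0)
      = (\<Sum>C\<in>of_kind Endpoint1 X. h C)"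
  proof (cases "kind B = Endpoint1")
    case True
    then have "B \<in> of_kind Endpoint1 X" using assms(3) by (simp add: of_kind_def)
    then show ?thesis using True assms(2) by (simp add: endpoint_kind_def sum.remove)
  next
    case False
    then have "of_kind Endpoint1 X - {B} = of_kind Endpoint1 X" by (auto simp: of_kind_def)
    then show ?thesis using False ns by (simp add: endpoint_kind_def)
  qed
  moreover have "\<exists>t0\<le>t. chooses_normal F \<gamma> pick n0 t0"
    if "of_kind Endpoint2 (X - {B}) \<noteq> {} \<or> endpoint_kind (kind B) = Endpoint2"
  proof (cases "kind B \<in> {Normal1, Normal2}")
    case True
    then show ?thesis using assms(4) by blast
  next
    case False
    then have "of_kind Endpoint2 X \<noteq> {}"
      using that assms(3) ns by (cases "kind B") (auto simp: of_kind_def endpoint_kind_def)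
    then show ?thesis using censusD(6)[OF assms(1)] by blast
  qed
  moreover have "inj_on h (normals (X - {B}))"
    using censusD(3)[OF assms(1)] by (auto intro: inj_on_subset)
  moreover have "\<forall>C\<in>X - {B}. kind C \<noteq> Stripe"
    using censusD(1)[OF assms(1)] by blast
  moreover have "\<forall>C\<in>normals (X - {B}). (\<exists>m\<in>{n0..<t}. h C = 1 / real m) \<and> h C powr \<gamma> \<le> w C \<and>
        w C \<le> (1 + \<sigma>) * h C powr \<gamma>"
    using censusD(2)[OF assms(1)] by simp
  ultimately show ?thesis
    using censusD(5)[OF assms(1)] card unfolding census_def by (simp split: if_splits)
qed

section \<open>The state invariant\<close>

text \<open>The bound on the widths is stated relative to the area of the LRP, which changes only at
  critical moments, so that packing into existing boxes trivially preserves it.\<close>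

definition balanced :: "state \<Rightarrow> bool" where
  "balanced s \<longleftrightarrow> height (lrp s) \<le> 2 * width (lrp s) \<and> (\<forall>B\<in>boxes s. w B \<le> 4 / c * area (lrp s))"

definition calm :: "nat \<Rightarrow> state \<Rightarrow> bool" where
  "calm t s \<longleftrightarrow> layout F n0 t s \<and> balanced s \<and> census t (boxes s) 0 0 (area (lrp s))"

definition in_row :: "nat \<Rightarrow> state \<Rightarrow> box \<Rightarrow> bool" where
  "in_row t s A \<longleftrightarrow> layout F n0 t s \<and> balanced s \<and> active s = Some A \<and> A \<in> boxes s \<and>
     n0 \<le> row_start s \<and> row_start s \<le> t \<and>
     wD F (row_start s) + slack \<gamma> (row_start s) \<le> breadth s A \<and>
     breadth s A \<le> 4 / c * area (lrp s) \<and>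
     (row_kind s = Stripe \<longrightarrow> breadth s A \<le> 2 / real (row_start s)) \<and>
     census t (boxes s - {A}) (if endpoint_kind (row_kind s) = Endpoint2 then 1 else 0)
       (if endpoint_kind (row_kind s) = Endpoint1
        then (if row_kind s = Stripe then 2 / real (row_start s) else h A) else 0) (area (lrp s))"

lemma S_com_le: "n0 \<le> t \<Longrightarrow> S_com F t \<le> 2 / real t"
proof -
  assume t: "n0 \<le> t"
  have "S_com F t \<le> 1 / (real t - 1)"
    using t n0_16 by (intro S_com_bounds) auto
  also have "\<dots> \<le> 2 / real t"
    using t n0_16 by (simp add: field_simps)
  finally show ?thesis .
qed

lemma area_lrp_le:
  assumes "layout F n0 t s"
  shows "area (lrp s) \<le> S_com F t"
proof -
  have "0 \<le> (\<Sum>B\<in>boxes s. area (shape B))"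
    using layout.boxes_shape[OF assms] proper_area by (intro sum_nonneg) force
  then show ?thesis using layout.total_area[OF assms] by linarith
qed

lemma in_row_step5:
  assumes row: "in_row t s A" and t: "n0 \<le> t" and fit: "hD F t < along s A"
    and mom: "moment F \<gamma> pick n0 (Suc t) = Some (step5 F t s)"
  shows "in_row (Suc t) (step5 F t s) (new_endpoint F t s)"
proof -
  let ?E = "new_endpoint F t s" and ?M = "new_normal F t s" and ?N = "row_start s"
  have t1: "1 \<le> t" "2 \<le> t" "0 < real t" using t n0_16 by auto
  have lay: "layout F n0 t s" and bal: "balanced s" and A: "active s = Some A" "A \<in> boxes s"
    and N: "n0 \<le> ?N" "?N \<le> t" and br: "wD F ?N + slack \<gamma> ?N \<le> breadth s A"
      "breadth s A \<le> 4 / c * area (lrp s)"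
      "row_kind s = Stripe \<longrightarrow> breadth s A \<le> 2 / real ?N"
    and cen: "census t (boxes s - {A}) (if endpoint_kind (row_kind s) = Endpoint2 then 1 else 0)
       (if endpoint_kind (row_kind s) = Endpoint1
        then (if row_kind s = Stripe then 2 / real (row_start s) else h A) else 0) (area (lrp s))"
    using row unfolding in_row_def by auto
  have N1: "1 \<le> ?N" using N n0_16 by simp
  have "wD F t \<le> wD F ?N" "slack \<gamma> t \<le> slack \<gamma> ?N" "0 < slack \<gamma> t"
    using wD_antimono[OF N1 N(2)] slack_antimono[OF _ N1 N(2)] slack_pos[OF t1(1)] gamma by auto
  then have b: "slack \<gamma> t \<le> breadth s ?M" "wD F t < breadth s A"
    using br(1) new_boxes_extents[OF A(1)] by auto
  have "4 / c * area (lrp s) \<le> 4 / c * (2 / real t)"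
    using area_lrp_le[OF lay] S_com_le[OF t] c by (intro mult_left_mono) auto
  then have "breadth s A \<le> 8 / (c * real t)" using br(2) by simp
  then have b2: "breadth s ?M \<le> 8 / (c * real t)"
    using wD_pos[OF t1(1), of F] new_boxes_extents[OF A(1)] by simp
  note new = layout_step5[OF lay A t t1(2) fit b(2)]
  note ins = new_boxes_inside[OF A(1) t1(1) fit b(2)]
  have kM: "kind ?M \<in> {Normal1, Normal2}"
    by (simp add: new_normal_def normal_kind_def)
  have kE: "kind ?E = endpoint_kind (row_kind s)"
    by (simp add: new_endpoint_def)
  have "?M \<in> B_norm F \<gamma> pick n0 (Suc t)"
    using mom kM by (simp add: B_norm_def boxes_at_def)
  then have wM: "w ?M \<le> (1 + \<sigma>) * h ?M powr \<gamma>" by (rule normal_width)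
  have al: "along s ?M = 1 / real t"
    using new_boxes_extents[OF A(1)] hD_eq by simp
  have small: "breadth s ?M \<le> 1 / real t"
  proof (rule ccontr)
    assume "\<not> breadth s ?M \<le> 1 / real t"
    then have "w ?M = 1 / real t" "h ?M = breadth s ?M"
      using al by (auto simp: w_along_breadth[of _ s] h_along_breadth[of _ s])
    moreover have "breadth s ?M powr \<gamma> \<le> (8 / (c * real t)) powr \<gamma>"
      using b2 b(1) \<open>0 < slack \<gamma> t\<close> gamma by (intro powr_mono2) auto
    then have "(1 + \<sigma>) * breadth s ?M powr \<gamma> \<le> 2 * (8 / (c * real t)) powr \<gamma>"
      using sigma by (intro mult_mono) auto
    ultimately show False
      using wM narrow[OF t] by simp
  qed
  then have hM: "h ?M = 1 / real t" and wM': "w ?M = breadth s ?M"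
    using al by (auto simp: w_along_breadth[of _ s] h_along_breadth[of _ s])
  have "h ?M powr \<gamma> = slack \<gamma> t"
    unfolding hM slack_def using t1 by (simp add: powr_divide powr_minus_divide)
  then have "h ?M powr \<gamma> \<le> w ?M"
    using b(1) wM' by simp
  then have cen': "census (Suc t) (insert ?M (boxes s - {A})) (if endpoint_kind (row_kind s) = Endpoint2 then 1 else 0)
       (if endpoint_kind (row_kind s) = Endpoint1
        then (if row_kind s = Stripe then 2 / real (row_start s) else h A) else 0) (area (lrp s))"
    using census_insert_normal[OF cen _ t new(2) kM hM _ wM] layout.finite_boxes[OF lay] by simp
  have "boxes (step5 F t s) - {?E} = insert ?M (boxes s - {A})"
    using new(1,3) A by auto
  moreover have "h ?E \<le> h A"
    by (rule inside_height[OF ins(1)])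
  ultimately have "census (Suc t) (boxes (step5 F t s) - {?E})
       (if endpoint_kind (row_kind (step5 F t s)) = Endpoint2 then 1 else 0)
       (if endpoint_kind (row_kind (step5 F t s)) = Endpoint1
        then (if row_kind (step5 F t s) = Stripe then 2 / real (row_start (step5 F t s)) else h ?E) else 0)
       (area (lrp (step5 F t s)))"
    using census_mono[OF cen'] by simp
  moreover have "balanced (step5 F t s)"
  proof -
    have "w ?E \<le> w A" "w ?M \<le> w A" using ins(1,2) inside_width by auto
    moreover have "w A \<le> 4 / c * area (lrp s)" using bal A(2) unfolding balanced_def by blast
    ultimately show ?thesis using bal unfolding balanced_def by auto
  qed
  moreover have "breadth (step5 F t s) ?E = breadth s A"
    using new_boxes_extents(2)[OF A(1)] by (simp add: breadth_def)
  ultimately show ?thesis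
    unfolding in_row_def using new(4) N br by simp
qed

lemma row_end:
  assumes row: "in_row t s A" and t: "n0 \<le> t" and k: "kind A = endpoint_kind (row_kind s)"
    and stop: "\<not> continues_row F \<gamma> t s"
  shows "calm t s"
proof -
  let ?N = "row_start s"
  have lay: "layout F n0 t s" and bal: "balanced s" and A: "active s = Some A" "A \<in> boxes s"
    and N: "n0 \<le> ?N" "?N \<le> t" and br: "row_kind s = Stripe \<longrightarrow> breadth s A \<le> 2 / real ?N"
    and cen: "census t (boxes s - {A}) (if endpoint_kind (row_kind s) = Endpoint2 then 1 else 0)
       (if endpoint_kind (row_kind s) = Endpoint1
        then (if row_kind s = Stripe then 2 / real (row_start s) else h A) else 0) (area (lrp s))"
    using row unfolding in_row_def by auto
  have N1: "1 \<le> ?N" using N n0_16 by simp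
  have "along s A < hD F t + slack \<gamma> ?N"
    using stop A(1) by (simp add: continues_row_def along_def)
  also have "\<dots> \<le> 1 / real ?N + 1 / real ?N"
    using N N1 slack_le[OF gamma(1) N1] by (intro add_mono) (auto simp: hD_eq field_simps)
  finally have "row_kind s = Stripe \<longrightarrow> h A \<le> 2 / real ?N"
    using br by (auto simp: h_along_breadth[of _ s])
  then have "census t (insert A (boxes s - {A})) 0 0 (area (lrp s))"
    using layout.finite_boxes[OF lay] k
    by (intro census_end_row[OF cen]) (auto simp: endpoint_kind_def)
  then show ?thesis
    using lay bal A(2) unfolding calm_def by (simp add: insert_absorb)
qed

lemma fits:
  assumes "n0 \<le> t" "wD F t + slack \<gamma> t \<le> w B" "s' = start_row t B s"
  shows "hD F t < along s' B" "along s' B = h B" "breadth s' B = w B"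
proof -
  show 1: "along s' B = h B" "breadth s' B = w B"
    using assms(3) by (simp_all add: along_def breadth_def)
  show "hD F t < along s' B"
    using hD_less[OF gamma(2), of t F] assms(1,2) n0_16 width_le_height[of "shape B"] unfolding 1 by simp
qed

lemma start_row_in_box:
  assumes calm: "calm t s" and t: "n0 \<le> t" and mom: "moment F \<gamma> pick n0 t = Some s"
    and stop: "\<not> continues_row F \<gamma> t s" and av: "box_available F \<gamma> pick n0 t s"
    and B: "B = pick n0 t (boxes s)"
  shows "in_row t (start_row t B s) B" "hD F t < along (start_row t B s) B"
proof -
  have lay: "layout F n0 t s" and bal: "balanced s" and cen: "census t (boxes s) 0 0 (area (lrp s))"
    using calm unfolding calm_def by auto
  have fin: "finite (boxes s)" by (rule layout.finite_boxes[OF lay])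
  have "boxes s \<noteq> {}" and wB: "wD F t + slack \<gamma> t \<le> w B"
    using av B unfolding box_available_def by auto
  then have BB: "B \<in> boxes s"
    using pick fin B unfolding max_width_choice_def by blast
  note f = fits[OF t wB refl, of s]
  show "hD F t < along (start_row t B s) B" by (rule f(1))
  have "kind B \<noteq> Stripe" using censusD(1)[OF cen] BB by blast
  have t1: "1 \<le> t" using t n0_16 by simp
  have "tall t \<le> h B \<and> chooses_normal F \<gamma> pick n0 t" if k: "kind B \<in> {Normal1, Normal2}"
  proof
    show "chooses_normal F \<gamma> pick n0 t"
      using mom stop av k B unfolding chooses_normal_def by blast
    have "B \<in> B_norm F \<gamma> pick n0 t"
      using mom k BB by (simp add: B_norm_def boxes_at_def)
    then have "w B \<le> (1 + \<sigma>) * h B powr \<gamma>" by (rule normal_width)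
    also have "\<dots> \<le> 2 * h B powr \<gamma>"
      using sigma by (intro mult_right_mono) auto
    finally have "wD F t \<le> 2 * h B powr \<gamma>"
      using wB slack_pos[OF t1, of \<gamma>] by linarith
    moreover have "1 / (2 * real t) \<le> 1 / (real t + 1)"
      using t1 by (simp add: field_simps)
    ultimately have "1 / (4 * real t) \<le> h B powr \<gamma>"
      using wD_bounds(2)[OF t1, of F] by simp
    then have "tall t \<le> (h B powr \<gamma>) powr (1 / \<gamma>)"
      unfolding tall_def using gamma by (intro powr_mono2) auto
    also have "\<dots> = h B"
    proof -
      have "0 < w B" using layout.boxes_shape[OF lay BB] proper_width by blast
      then show ?thesis
        using gamma width_le_height[of "shape B"] by (simp add: powr_powr)
    qed
    finally show "tall t \<le> h B" .
  qed
  then have "census t (boxes s - {B}) (if endpoint_kind (kind B) = Endpoint2 then 1 else 0)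
     (if endpoint_kind (kind B) = Endpoint1 then h B else 0) (area (lrp s))"
    by (intro census_remove[OF cen fin BB])
  moreover have "w B \<le> 4 / c * area (lrp s)" using bal BB unfolding balanced_def by blast
  moreover have "balanced (start_row t B s)" using bal unfolding balanced_def by simp
  ultimately show "in_row t (start_row t B s) B"
    unfolding in_row_def using lay BB t wB f \<open>kind B \<noteq> Stripe\<close> by (simp split del: if_split cong: if_cong)
qed

lemma start_row_in_stripe:
  assumes calm: "calm t s" and t: "n0 \<le> t" and large: "c * S_com F t < area (lrp s)"
    and thin: "\<forall>B\<in>boxes s. w B < wD F t + slack \<gamma> t"
    and d: "d = long_dir (lrp s)" and l: "l = wD F t + slack \<gamma> t"
    and B: "B = Box Stripe (cut_off d l (lrp s))"
    and s': "s' = start_row t B (s\<lparr>lrp := cut_rest d l (lrp s), boxes := insert B (boxes s)\<rparr>)"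
  shows "hD F t + slack \<gamma> t \<le> width (lrp s)" "in_row t s' B" "hD F t < along s' B"
proof -
  let ?L = "lrp s" and ?L' = "cut_rest d l (lrp s)"
  let ?W = "width ?L" and ?H = "height ?L"
  have t1: "1 \<le> t" "2 \<le> t" "0 < real t" using t n0_16 by auto
  have lay: "layout F n0 t s" and bal: "balanced s" and cen: "census t (boxes s) 0 0 (area ?L)"
    using calm unfolding calm_def by auto
  have aspect: "?H \<le> 2 * ?W" using bal unfolding balanced_def by blast
  have WH: "?W \<le> ?H" by (rule width_le_height)
  have Wpos: "0 < ?W" using layout.proper_lrp[OF lay] proper_width by blast
  have A: "area ?L = ?W * ?H" by (simp add: area_def)
  have "1 / real t \<le> S_com F t" using S_com_bounds(1)[OF t1(2)] .
  then have "c * (1 / real t) \<le> c * S_com F t" using c by (intro mult_left_mono) auto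
  then have At: "c / real t < area ?L" using large by simp
  have "16 / c \<le> real t" using n0 t by linarith
  then have "(4 / real t)\<^sup>2 \<le> c / real t"
    using t1 c by (simp add: power2_eq_square field_simps)
  then have A4: "(4 / real t)\<^sup>2 < area ?L" using At by linarith
  have H4: "4 / real t < ?H"
  proof -
    have "area ?L \<le> ?H\<^sup>2"
      unfolding A power2_eq_square using WH Wpos by (intro mult_right_mono) auto
    then have "(4 / real t)\<^sup>2 < ?H\<^sup>2" using A4 by linarith
    then show ?thesis by (rule power_less_imp_less_base) (use Wpos WH in simp)
  qed
  have W2: "2 / real t < ?W" using H4 aspect by (simp add: field_simps)
  have sl: "slack \<gamma> t \<le> 1 / real t" "0 < slack \<gamma> t"
    using slack_le[OF gamma(1) t1(1)] slack_pos[OF t1(1)] by auto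
  have l2: "l \<le> 2 / real t" "0 < l" "1 / (2 * real t) \<le> l"
  proof -
    show "l \<le> 2 / real t" "0 < l"
      using wD_bounds(1)[OF t1(1), of F] wD_pos[OF t1(1), of F] sl l by auto
    have "1 / (2 * real t) \<le> 1 / (real t + 1)"
      using t1 by (simp add: field_simps)
    then show "1 / (2 * real t) \<le> l"
      using wD_bounds(2)[OF t1(1), of F] sl l by linarith
  qed
  show "hD F t + slack \<gamma> t \<le> width (lrp s)"
    using W2 sl by (simp add: hD_eq)
  have lH: "l < ?H" "l \<le> ?W" "2 * l \<le> ?H" using l2 H4 W2 by (auto simp: field_simps)
  note str = layout_stripe[OF lay l2(2) lH(1) d B]
  have ext: "extent d ?L = ?H" "extent (across d) ?L = ?W" using d by simp_all
  have wB: "w B = l" "h B = ?W"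
    using lH B ext by (simp_all add: width_extent[of "cut_off d l ?L" d] height_extent[of "cut_off d l ?L" d])
  have L': "width ?L' = min (?H - l) ?W" "height ?L' = max (?H - l) ?W" "area ?L' = (?H - l) * ?W"
    using ext by (simp_all add: width_extent[of ?L' d] height_extent[of ?L' d] area_extent[of ?L' d])
  have asp': "height ?L' \<le> 2 * width ?L'"
    using aspect WH lH l2(2) unfolding L' by (auto simp: min_def max_def)
  have A': "area ?L / 2 \<le> area ?L'"
  proof -
    have "?W * (2 * l) \<le> ?W * ?H" using lH(3) Wpos by (intro mult_left_mono) auto
    moreover have "area ?L' = ?W * ?H - ?W * l" unfolding L' by (simp add: algebra_simps)
    ultimately show ?thesis unfolding A by linarith
  qed
  have width': "2 / real t \<le> 4 / c * area ?L'"
  proof -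
    have "2 / c * (c / real t) \<le> 2 / c * (2 * area ?L')"
      using At A' c by (intro mult_left_mono) auto
    then show ?thesis using c by simp
  qed
  have drop: "2 / real t \<le> 16 * (sqrt (area ?L) - sqrt (area ?L'))"
  proof -
    let ?a = "sqrt (area ?L)" and ?b = "sqrt (area ?L')"
    have pos: "0 < area ?L" using layout.proper_lrp[OF lay] proper_area by blast
    have "0 \<le> area ?L'" using A' pos by simp
    have ba: "?b \<le> ?a" using l2(2) Wpos unfolding L' A by (simp add: algebra_simps)
    have "?a \<le> 2 * ?W"
    proof (rule real_le_lsqrt)
      show "area ?L \<le> (2 * ?W)\<^sup>2"
        using mult_left_mono[OF aspect, of ?W] Wpos unfolding A by (simp add: power2_eq_square)
    qed (use pos Wpos in auto)
    have "?a * l \<le> 2 * ?W * l"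
      using \<open>?a \<le> 2 * ?W\<close> l2 by (intro mult_right_mono) auto
    also have "\<dots> = 2 * (?a * ?a - ?b * ?b)"
      using pos \<open>0 \<le> area ?L'\<close> unfolding L' A by (simp add: algebra_simps)
    also have "\<dots> = 2 * ((?a + ?b) * (?a - ?b))"
      by (simp add: algebra_simps)
    also have "\<dots> \<le> 2 * ((?a + ?a) * (?a - ?b))"
      using ba by (intro mult_left_mono mult_right_mono) auto
    also have "\<dots> = ?a * (4 * (?a - ?b))"
      by (simp add: algebra_simps)
    finally have "l \<le> 4 * (?a - ?b)"
      using pos by simp
    then show ?thesis using l2(3) by (simp add: field_simps)
  qed
  have "census t (boxes s) 0 (2 / real t) (area ?L')"
    using cen drop unfolding census_def by simp
  moreover have "boxes s' - {B} = boxes s" "lrp s' = ?L'" "row_kind s' = Stripe" "row_start s' = t"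
    using str(1) B s' by auto
  moreover have f: "hD F t < along s' B" "breadth s' B = l"
    using fits[OF t _ s'] wB l by auto
  moreover have "layout F n0 t s'" using str(2) unfolding s' layout_start_row .
  moreover have "\<forall>C\<in>boxes s'. w C \<le> 4 / c * area ?L'"
  proof
    fix C assume "C \<in> boxes s'"
    then have "C = B \<or> C \<in> boxes s" using s' by auto
    then have "w C \<le> l" using thin l wB by fastforce
    then show "w C \<le> 4 / c * area ?L'" using l2(1) width' by linarith
  qed
  moreover have "active s' = Some B" "B \<in> boxes s'" using s' by auto
  ultimately show "in_row t s' B"
    unfolding in_row_def balanced_def using asp' l l2(1) width' t by (simp add: endpoint_kind_def)
  show "hD F t < along s' B" by (fact f)
qed

section \<open>Critical moments\<close>

lemma normal_area:
  assumes cen: "census t X p q L" and fin: "finite X" and t: "n0 \<le> t"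
    and thin: "\<forall>B\<in>X. w B < 1 / real t + slack \<gamma> t"
  shows "(\<Sum>B\<in>normals X. area (shape B))
    \<le> (1 + \<sigma>) * ((1 / (1 / real t + slack \<gamma> t) powr (1 / \<gamma>) - 1) powr (- \<gamma>) / \<gamma>)"
proof -
  define u where "u = 1 / real t + slack \<gamma> t"
  define x where "x = 1 / u powr (1 / \<gamma>)"
  have t1: "1 \<le> t" using t n0_16 by simp
  have u: "0 < u" "u powr (1 / \<gamma>) < 1"
    unfolding u_def using t1 slack_pos[OF t1, of \<gamma>] tail_start[OF t] by (auto intro: add_pos_pos)
  have x: "1 < x" using u by (simp add: x_def)
  define idx where "idx B = nat \<lfloor>1 / h B\<rfloor>" for B
  have idx: "h B = 1 / real (idx B) \<and> 1 \<le> idx B" if "B \<in> normals X" for B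
  proof -
    obtain m where m: "m \<in> {n0..<t}" "h B = 1 / real m"
      using censusD(2)[OF cen] \<open>B \<in> normals X\<close> by blast
    then show ?thesis using n0_16 by (simp add: idx_def)
  qed
  have inj: "inj_on idx (normals X)"
    using idx censusD(3)[OF cen] by (auto simp: inj_on_def)
  have area: "area (shape B) \<le> (1 + \<sigma>) * real (idx B) powr (- (1 + \<gamma>))" if B: "B \<in> normals X" for B
  proof -
    have i: "0 < real (idx B)" using idx[OF B] by simp
    have "w B \<le> (1 + \<sigma>) * h B powr \<gamma>" using censusD(2)[OF cen] B by blast
    then have "w B * h B \<le> (1 + \<sigma>) * h B powr \<gamma> * h B"
      using idx[OF B] by (intro mult_right_mono) auto
    also have "\<dots> = (1 + \<sigma>) * real (idx B) powr (- (1 + \<gamma>))"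
    proof -
      have "real (idx B) powr (- (1 + \<gamma>)) = 1 / (real (idx B) * real (idx B) powr \<gamma>)"
        using i by (subst powr_minus_divide) (simp add: powr_add)
      then show ?thesis using i idx[OF B] by (simp add: powr_divide)
    qed
    finally show ?thesis by (simp add: area_def)
  qed
  have "x \<le> real m" if m: "m \<in> idx ` normals X" for m
  proof -
    obtain B where B: "B \<in> normals X" "m = idx B" using m by blast
    have "h B powr \<gamma> \<le> w B" using censusD(2)[OF cen] B(1) by blast
    also have "w B < u" using thin B(1) by (auto simp: normals_def u_def)
    finally have "(h B powr \<gamma>) powr (1 / \<gamma>) \<le> u powr (1 / \<gamma>)"
      using gamma by (intro powr_mono2) auto
    then have "h B \<le> u powr (1 / \<gamma>)"
      using gamma idx[OF B(1)] by (simp add: powr_powr)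
    then show ?thesis
      using idx[OF B(1)] B(2) u unfolding x_def by (simp add: field_simps)
  qed
  then have sum: "(\<Sum>m\<in>idx ` normals X. real m powr (- (1 + \<gamma>))) \<le> (x - 1) powr (- \<gamma>) / \<gamma>"
    using fin x gamma by (intro powr_tail_sum) auto
  have "(\<Sum>B\<in>normals X. area (shape B)) \<le> (\<Sum>B\<in>normals X. (1 + \<sigma>) * real (idx B) powr (- (1 + \<gamma>)))"
    by (rule sum_mono) (rule area)
  also have "\<dots> = (1 + \<sigma>) * (\<Sum>m\<in>idx ` normals X. real m powr (- (1 + \<gamma>)))"
    by (simp add: sum.reindex[OF inj] sum_distrib_left)
  also have "\<dots> \<le> (1 + \<sigma>) * ((x - 1) powr (- \<gamma>) / \<gamma>)"
    using sum sigma by (intro mult_left_mono) auto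
  finally show ?thesis unfolding x_def u_def .
qed

lemma endpoint2_card:
  assumes cen: "census t X p q L" and t: "n0 \<le> t"
  shows "real (card (of_kind Endpoint2 X)) \<le> (4 * real t) powr (1 / \<gamma>)"
proof -
  have t1: "0 < real t" using t n0_16 by simp
  then have tall: "0 < tall t" by (simp add: tall_def)
  have "card {m\<in>{n0..<t}. tall t \<le> 1 / real m} \<le> card {1..nat \<lfloor>1 / tall t\<rfloor>}"
  proof (rule card_mono)
    show "{m\<in>{n0..<t}. tall t \<le> 1 / real m} \<subseteq> {1..nat \<lfloor>1 / tall t\<rfloor>}"
    proof
      fix m assume m: "m \<in> {m\<in>{n0..<t}. tall t \<le> 1 / real m}"
      then have "1 \<le> m" using n0_16 by simp
      then have "real m \<le> 1 / tall t" using m tall by (simp add: field_simps)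
      then show "m \<in> {1..nat \<lfloor>1 / tall t\<rfloor>}" using \<open>1 \<le> m\<close> by (simp add: le_nat_floor)
    qed
  qed simp
  then have "card (of_kind Endpoint2 X) \<le> nat \<lfloor>1 / tall t\<rfloor>"
    using censusD(4)[OF cen, rule_format, OF tall] by simp
  moreover have "real (nat \<lfloor>1 / tall t\<rfloor>) \<le> 1 / tall t"
    using tall by simp
  ultimately have "real (card (of_kind Endpoint2 X)) \<le> 1 / tall t"
    using order_trans of_nat_mono by meson
  also have "\<dots> = (4 * real t) powr (1 / \<gamma>)"
    using t1 by (simp add: tall_def powr_divide)
  finally show ?thesis .
qed

lemma endpoint1_area:
  assumes cen: "census t X 0 0 L" and fin: "finite X" and L: "0 \<le> L"
    and pos: "\<forall>B\<in>X. 0 < w B" and thin: "\<forall>B\<in>X. w B < u"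
  shows "(\<Sum>B\<in>of_kind Endpoint1 X. area (shape B)) \<le> max 0 u * (16 * sqrt (1 / (real n0 - 1)))"
proof -
  have "(\<Sum>B\<in>of_kind Endpoint1 X. area (shape B)) \<le> (\<Sum>B\<in>of_kind Endpoint1 X. max 0 u * h B)"
  proof (rule sum_mono)
    fix B assume "B \<in> of_kind Endpoint1 X"
    then have B: "0 < w B" "w B < u" using pos thin by (auto simp: of_kind_def)
    then show "area (shape B) \<le> max 0 u * h B"
      unfolding area_def using width_le_height[of "shape B"] by (intro mult_right_mono) auto
  qed
  also have "\<dots> = max 0 u * (\<Sum>B\<in>of_kind Endpoint1 X. h B)"
    by (simp add: sum_distrib_left)
  also have "\<dots> \<le> max 0 u * (16 * sqrt (1 / (real n0 - 1)))"
  proof (intro mult_left_mono)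
    have "sqrt (S_com F n0) \<le> sqrt (1 / (real n0 - 1))"
      using S_com_bounds(2)[of n0 F] n0_16 by (intro real_sqrt_le_mono) auto
    moreover have "0 \<le> sqrt L" using L by simp
    ultimately show "(\<Sum>B\<in>of_kind Endpoint1 X. h B) \<le> 16 * sqrt (1 / (real n0 - 1))"
      using censusD(5)[OF cen] by argo
  qed simp
  finally show ?thesis .
qed

lemma endpoint2_area:
  assumes cen: "census t (boxes s) 0 0 L" and fin: "finite (boxes s)" and t: "n0 \<le> t"
    and mom: "moment F \<gamma> pick n0 t = Some s"
    and crit: "t \<in> T_crit F \<gamma> pick n0"
    and pos: "\<forall>B\<in>boxes s. 0 < w B" and thin: "\<forall>B\<in>boxes s. w B < u"
  shows "(\<Sum>B\<in>of_kind Endpoint2 (boxes s). area (shape B))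
    \<le> u\<^sup>2 * ((4 * real t) powr (1 / \<gamma>) * (K * ln (real t)))"
proof (cases "of_kind Endpoint2 (boxes s) = {}")
  case True
  then show ?thesis using K t n0_16 by simp
next
  case False
  let ?X = "of_kind Endpoint2 (boxes s)"
  have X: "B_ep2 F \<gamma> pick n0 t = ?X"
    using mom by (simp add: B_ep2_def boxes_at_def of_kind_def)
  have fX: "finite ?X" using fin by simp
  obtain t' where t': "t' \<le> t" "chooses_normal F \<gamma> pick n0 t'"
    using censusD(6)[OF cen] False by blast
  define t0 where "t0 = (LEAST t. chooses_normal F \<gamma> pick n0 t)"
  have "is_t0 F \<gamma> pick n0 t0"
    unfolding is_t0_def t0_def using t'(2) by (auto intro: LeastI dest: not_less_Least)
  moreover have "t0 < t"
  proof -
    have "\<not> chooses_normal F \<gamma> pick n0 t"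
      using crit by (auto simp: T_crit_def chooses_normal_def)
    moreover have "t0 \<le> t'" "chooses_normal F \<gamma> pick n0 t0"
      unfolding t0_def using t'(2) by (auto intro: Least_le LeastI)
    ultimately show ?thesis using t'(1) by (metis le_neq_implies_less le_trans)
  qed
  ultimately have "1 / real (card ?X) * (\<Sum>B\<in>?X. h B / w B) \<le> K * ln (real t)"
    using endpoint_ratio crit X by metis
  then have ratio: "(\<Sum>B\<in>?X. h B / w B) \<le> real (card ?X) * (K * ln (real t))"
    using False fX by (simp add: field_simps card_gt_0_iff)
  have "(\<Sum>B\<in>?X. area (shape B)) \<le> (\<Sum>B\<in>?X. u\<^sup>2 * (h B / w B))"
  proof (rule sum_mono)
    fix B assume "B \<in> ?X"
    then have B: "0 < w B" "w B < u" using pos thin by (auto simp: of_kind_def)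
    have "0 \<le> h B" using B(1) width_le_height[of "shape B"] by simp
    have "area (shape B) = (w B)\<^sup>2 * (h B / w B)"
      using B by (simp add: area_def power2_eq_square)
    also have "\<dots> \<le> u\<^sup>2 * (h B / w B)"
      using B \<open>0 \<le> h B\<close> by (intro mult_right_mono power_mono) auto
    finally show "area (shape B) \<le> u\<^sup>2 * (h B / w B)" .
  qed
  also have "\<dots> = u\<^sup>2 * (\<Sum>B\<in>?X. h B / w B)"
    by (simp add: sum_distrib_left)
  also have "\<dots> \<le> u\<^sup>2 * (real (card ?X) * (K * ln (real t)))"
    using ratio by (intro mult_left_mono) auto
  also have "\<dots> \<le> u\<^sup>2 * ((4 * real t) powr (1 / \<gamma>) * (K * ln (real t)))"
    using endpoint2_card[OF cen t] K t n0_16 by (intro mult_left_mono mult_right_mono) auto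
  finally show ?thesis .
qed

lemma sum_by_kind:
  assumes "finite X" "\<forall>B\<in>X. kind B \<noteq> Stripe"
  shows "(\<Sum>B\<in>X. f B) = (\<Sum>B\<in>normals X. f B) + (\<Sum>B\<in>of_kind Endpoint1 X. f B) +
     (\<Sum>B\<in>of_kind Endpoint2 X. f B :: real)"
proof -
  have "B \<in> (normals X \<union> of_kind Endpoint1 X) \<union> of_kind Endpoint2 X" if "B \<in> X" for B
    using that assms(2) by (cases "kind B") (auto simp: normals_def of_kind_def)
  then have X: "X = (normals X \<union> of_kind Endpoint1 X) \<union> of_kind Endpoint2 X"
    by (auto simp: normals_def of_kind_def)
  have "(\<Sum>B\<in>X. f B) = (\<Sum>B\<in>(normals X \<union> of_kind Endpoint1 X) \<union> of_kind Endpoint2 X. f B)"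
    by (rule arg_cong[OF X])
  also have "\<dots> = (\<Sum>B\<in>normals X \<union> of_kind Endpoint1 X. f B) + (\<Sum>B\<in>of_kind Endpoint2 X. f B)"
    using assms(1) by (intro sum.union_disjoint) (auto simp: normals_def of_kind_def)
  also have "(\<Sum>B\<in>normals X \<union> of_kind Endpoint1 X. f B) = (\<Sum>B\<in>normals X. f B) + (\<Sum>B\<in>of_kind Endpoint1 X. f B)"
    using assms(1) by (intro sum.union_disjoint) (auto simp: normals_def of_kind_def)
  finally show ?thesis .
qed

lemma critical:
  assumes calm: "calm t s" and t: "n0 \<le> t" and mom: "moment F \<gamma> pick n0 t = Some s"
    and stop: "\<not> continues_row F \<gamma> t s" and av: "\<not> box_available F \<gamma> pick n0 t s"
  shows "\<forall>B\<in>boxes s. w B < wD F t + slack \<gamma> t" "c * S_com F t < area (lrp s)"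
proof -
  have lay: "layout F n0 t s" and cen: "census t (boxes s) 0 0 (area (lrp s))"
    using calm unfolding calm_def by auto
  have fin: "finite (boxes s)" by (rule layout.finite_boxes[OF lay])
  have t1: "1 \<le> t" "2 \<le> t" using t n0_16 by auto
  show thin: "\<forall>B\<in>boxes s. w B < wD F t + slack \<gamma> t"
  proof
    fix B assume B: "B \<in> boxes s"
    then have "w B \<le> w (pick n0 t (boxes s))"
      using pick fin unfolding max_width_choice_def by blast
    then show "w B < wD F t + slack \<gamma> t"
      using av B unfolding box_available_def by force
  qed
  define u where "u = 1 / real t + slack \<gamma> t"
  have thin': "\<forall>B\<in>boxes s. w B < u"
    using thin wD_bounds(1)[OF t1(1), of F] unfolding u_def by fastforce
  have u: "0 < u" unfolding u_def using t1 slack_pos[OF t1(1)] by (intro add_pos_pos) auto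
  have pos: "\<forall>B\<in>boxes s. 0 < w B"
    using layout.boxes_shape[OF lay] proper_width by blast
  have crit: "t \<in> T_crit F \<gamma> pick n0"
    using mom stop av unfolding T_crit_def by blast
  have "(\<Sum>B\<in>boxes s. area (shape B)) = (\<Sum>B\<in>normals (boxes s). area (shape B)) +
      (\<Sum>B\<in>of_kind Endpoint1 (boxes s). area (shape B)) + (\<Sum>B\<in>of_kind Endpoint2 (boxes s). area (shape B))"
    using sum_by_kind[OF fin censusD(1)[OF cen]] .
  also have "\<dots> < (1 - c) * (1 / real t)"
  proof -
    have "(\<Sum>B\<in>of_kind Endpoint1 (boxes s). area (shape B)) \<le> max 0 u * (16 * sqrt (1 / (real n0 - 1)))"
      using endpoint1_area[OF cen fin _ pos thin'] proper_area[OF layout.proper_lrp[OF lay]] by simp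
    then show ?thesis
      using normal_area[OF cen fin t thin'[unfolded u_def]]
        endpoint2_area[OF cen fin t mom crit pos thin'] budget[OF t] u unfolding u_def by simp
  qed
  also have "\<dots> \<le> (1 - c) * S_com F t"
    using S_com_bounds(1)[OF t1(2)] c by (intro mult_left_mono) auto
  finally show "c * S_com F t < area (lrp s)"
    using layout.total_area[OF lay] by (simp add: algebra_simps)
qed

section \<open>The run\<close>

definition invariant :: "nat \<Rightarrow> state \<Rightarrow> bool" where
  "invariant t s \<longleftrightarrow> calm t s \<and> active s = None \<or>
     (\<exists>A. in_row t s A \<and> kind A = endpoint_kind (row_kind s))"

lemma invariant_layout: "invariant t s \<Longrightarrow> layout F n0 t s"
  unfolding invariant_def calm_def in_row_def by blast

lemma invariant_calm:
  "invariant t s \<Longrightarrow> n0 \<le> t \<Longrightarrow> \<not> continues_row F \<gamma> t s \<Longrightarrow> calm t s"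
  unfolding invariant_def using row_end by blast

lemma S_com_pos: "n0 \<le> t \<Longrightarrow> 0 < S_com F t"
  by (rule less_le_trans[OF _ S_com_bounds(1)]) (use n0_16 in auto)

lemma invariant_step1: "invariant n0 (step1 F n0)"
proof -
  have "layout F n0 n0 (step1 F n0)"
    using S_com_pos[of n0]
    by unfold_locales (auto simp: step1_def inside_refl proper_def sheet_def area_eq)
  moreover have "balanced (step1 F n0)"
    using S_com_pos[of n0] by (auto simp: balanced_def step1_def sheet_def height_def width_def)
  moreover have "area (sheet F n0) = S_com F n0"
    using S_com_pos[of n0] by (simp add: sheet_def area_eq)
  ultimately show ?thesis
    unfolding invariant_def calm_def using census_empty by (auto simp: step1_def)
qed

lemma invariant_step2:
  assumes inv: "invariant t s" and t: "n0 \<le> t" and mom: "moment F \<gamma> pick n0 t = Some s"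
  shows "\<exists>s'. step2 F \<gamma> pick n0 t s = Some s' \<and> invariant (Suc t) s' \<and>
    placed s' = (placed s)(t \<mapsto> the (placed s' t))"
proof -
  have next_moment: "moment F \<gamma> pick n0 (Suc t) = step2 F \<gamma> pick n0 t s"
    using mom t by (auto simp: moment_def Suc_diff_le split: if_splits)
  have finish: ?thesis if "in_row t s' A" "hD F t < along s' A" "placed s' = placed s"
    "step2 F \<gamma> pick n0 t s = Some (step5 F t s')" for s' A
  proof -
    have "in_row (Suc t) (step5 F t s') (new_endpoint F t s')"
      using in_row_step5[OF that(1) t that(2)] that(4) next_moment by simp
    then have "invariant (Suc t) (step5 F t s')"
      unfolding invariant_def by (auto simp: new_endpoint_def)
    then show ?thesis using that(3,4) by simp
  qed
  show ?thesis
  proof (cases "continues_row F \<gamma> t s")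
    case True
    then obtain A where A: "in_row t s A"
      using inv unfolding invariant_def continues_row_def by auto
    then have "active s = Some A" "1 \<le> row_start s" using n0_16 unfolding in_row_def by auto
    then have "hD F t < along s A"
      using True slack_pos[of "row_start s" \<gamma>] by (simp add: continues_row_def along_def)
    then show ?thesis using finish[OF A] True by (simp add: step2_def)
  next
    case False
    have calm: "calm t s" by (rule invariant_calm[OF inv t False])
    show ?thesis
    proof (cases "box_available F \<gamma> pick n0 t s")
      case True
      show ?thesis
        using finish[OF start_row_in_box[OF calm t mom False True refl]] False True
        by (simp add: step2_def step3_def)
    next
      case noav: False
      note crit = critical[OF calm t mom False noav]
      note stripe = start_row_in_stripe[OF calm t crit(2,1) refl refl refl refl]
      show ?thesis
        using finish[OF stripe(2,3)] stripe(1) False noav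
        by (simp add: step2_def step3_def step4_def Let_def)
    qed
  qed
qed

lemma run_invariant: "\<exists>s. run F \<gamma> pick n0 k = Some s \<and> invariant (n0 + k) s"
proof (induction k)
  case 0
  then show ?case using invariant_step1 by simp
next
  case (Suc k)
  then obtain s where s: "run F \<gamma> pick n0 k = Some s" "invariant (n0 + k) s" by blast
  then have "moment F \<gamma> pick n0 (n0 + k) = Some s" by (simp add: moment_def)
  then show ?case using invariant_step2[OF s(2)] s(1) by auto
qed

lemma moment_invariant:
  "n0 \<le> t \<Longrightarrow> \<exists>s. moment F \<gamma> pick n0 t = Some s \<and> invariant t s"
  using run_invariant[of "t - n0"] by (auto simp: moment_def)

lemma moment_placed:
  assumes "moment F \<gamma> pick n0 t = Some s" "n0 \<le> m" "m < t"
  shows "placed s m = Some (placement F \<gamma> pick n0 m)"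
  using assms(3,1)
proof (induction t arbitrary: s)
  case (Suc t)
  have t: "n0 \<le> t" using Suc.prems(1) assms(2) by simp
  obtain r where r: "moment F \<gamma> pick n0 t = Some r" "invariant t r"
    using moment_invariant[OF t] by blast
  have "moment F \<gamma> pick n0 (Suc t) = step2 F \<gamma> pick n0 t r"
    using r(1) t by (auto simp: moment_def Suc_diff_le split: if_splits)
  then have s: "placed s = (placed r)(t \<mapsto> the (placed s t))" "invariant (Suc t) s"
    using invariant_step2[OF r(2) t r(1)] Suc.prems(2) by auto
  show ?case
  proof (cases "m = t")
    case True
    have "placed s t \<noteq> None"
      using layout.placed_dom[OF invariant_layout[OF s(2)]] t by simp
    then show ?thesis using True Suc.prems(2) by (simp add: placement_def)
  next
    case False
    then have "placed r m = Some (placement F \<gamma> pick n0 m)"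
      using Suc.IH[OF _ r(1)] Suc.prems(1) by simp
    moreover have "placed s m = placed r m"
      using fun_cong[OF s(1), of m] False by simp
    ultimately show ?thesis by simp
  qed
qed simp

lemma critical_ratio:
  assumes "t \<in> T_crit F \<gamma> pick n0"
  shows "c < S_LRP F \<gamma> pick n0 t / S_com F t"
proof -
  obtain s where s: "moment F \<gamma> pick n0 t = Some s" "\<not> continues_row F \<gamma> t s"
    "\<not> box_available F \<gamma> pick n0 t s"
    using assms unfolding T_crit_def by blast
  have t: "n0 \<le> t" using s(1) by (auto simp: moment_def split: if_splits)
  have "invariant t s" using moment_invariant[OF t] s(1) by auto
  then have "c * S_com F t < area (lrp s)"
    using critical(2)[OF invariant_calm t s] t s(2) by blast
  moreover have "0 < S_com F t" by (rule S_com_pos[OF t])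
  ultimately show ?thesis using s(1) by (simp add: S_LRP_def field_simps)
qed

lemma never_fails: "never_fails F \<gamma> pick n0"
  unfolding never_fails_def using moment_invariant by (metis option.distinct(1))

lemma packing: "perfect_packing F n0 (placement F \<gamma> pick n0)"
proof -
  let ?P = "placement F \<gamma> pick n0"
  have shape: "width (?P n) = wD F n \<and> height (?P n) = hD F n \<and> inside (?P n) (sheet F n0)"
    if n: "n0 \<le> n" for n
  proof -
    obtain s where s: "moment F \<gamma> pick n0 (Suc n) = Some s" "invariant (Suc n) s"
      using moment_invariant[OF le_SucI[OF n]] by blast
    show ?thesis
      using layout.placed_shape[OF invariant_layout[OF s(2)] moment_placed[OF s(1) n]] by simp
  qed
  have apart: "apart (?P m) (?P n)" if mn: "n0 \<le> m" "n0 \<le> n" "m \<noteq> n" for m n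
  proof -
    obtain s where s: "moment F \<gamma> pick n0 (Suc (max m n)) = Some s" "invariant (Suc (max m n)) s"
      using moment_invariant[of "Suc (max m n)"] mn(1) by (meson le_SucI max.coboundedI1)
    show ?thesis
      using layout.placed_apart[OF invariant_layout[OF s(2)] moment_placed[OF s(1) mn(1)]
          moment_placed[OF s(1) mn(2)] mn(3)] by simp
  qed
  have "area (sheet F n0) = S_com F n0"
    using S_com_pos[of n0] by (simp add: sheet_def area_eq)
  moreover have "(\<lambda>k. wD F (n0 + k) * hD F (n0 + k)) sums S_com F n0"
    unfolding S_com_def using S_com_bounds(4)[of n0 F] n0_16 by (intro summable_sums) auto
  ultimately have sums: "(\<lambda>k. area (?P (n0 + k))) sums area (sheet F n0)"
    using shape by (simp add: area_def)
  moreover have "region (?P n) \<subseteq> region (sheet F n0)" if "n0 \<le> n" for n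
    using region_mono shape[OF that] by simp
  moreover have "interior (region (?P m)) \<inter> interior (region (?P n)) = {}"
    if "n0 \<le> m" "n0 \<le> n" "m \<noteq> n" for m n
    by (rule apart_interior[OF apart[OF that]])
  ultimately show ?thesis
    unfolding perfect_packing_def using shape by simp
qed

end

section \<open>Asymptotics\<close>

lemma budget_limit:
  assumes "1 < \<gamma>"
  shows "(\<lambda>t. real t * ((1 + \<sigma>) * ((1 / (1 / real t + slack \<gamma> t) powr (1 / \<gamma>) - 1) powr (- \<gamma>) / \<gamma>)))
      \<longlonglongrightarrow> (1 + \<sigma>) / \<gamma>"
    and "(\<lambda>t. real t * ((1 / real t + slack \<gamma> t)\<^sup>2 * ((4 * real t) powr (1 / \<gamma>) * (K * ln (real t)))))
      \<longlonglongrightarrow> 0"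
  unfolding slack_def using assms by (real_asymp simp: divide_inverse, real_asymp)

lemma eventually_bounds:
  assumes "1 < \<gamma>" "0 < c"
  shows "eventually (\<lambda>t. 2 * (8 / (c * real t)) powr \<gamma> < 1 / real t) sequentially"
    and "eventually (\<lambda>t. (1 / real t + slack \<gamma> t) powr (1 / \<gamma>) < 1) sequentially"
  unfolding slack_def using assms by real_asymp+

lemma slack_pack_large:
  fixes \<gamma> \<delta> :: real
  assumes \<gamma>: "1 < \<gamma>" "\<gamma> < 2" and pick: "max_width_choice pick"
    and A1: "assumption1 F \<gamma> pick" and A2: "assumption2 F \<gamma> pick"
    and \<delta>: "0 < \<delta>" "\<delta> < 1 - 1 / \<gamma>"
  shows "\<exists>n1\<ge>1. \<forall>n0\<ge>n1. \<exists>\<sigma> K. slack_pack F \<gamma> pick n0 \<sigma> (1 - 1 / \<gamma> - \<delta>) K"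
proof -
  define c where "c = 1 - 1 / \<gamma> - \<delta>"
  have "0 < 1 / \<gamma>" using \<gamma> by simp
  then have c: "0 < c" "c \<le> 1" unfolding c_def using \<delta> by linarith+
  define \<sigma> where "\<sigma> = min 1 (\<delta> * \<gamma> / 4)"
  have \<sigma>: "0 < \<sigma>" "\<sigma> \<le> 1" "\<sigma> \<le> \<delta> * \<gamma> / 4" unfolding \<sigma>_def using \<gamma> \<delta> by auto
  have \<sigma>\<gamma>: "(1 + \<sigma>) / \<gamma> \<le> 1 / \<gamma> + \<delta> / 4" using \<sigma>(3) \<gamma> by (simp add: field_simps)
  obtain n1 where n1: "\<And>n0 t B. n1 \<le> n0 \<Longrightarrow> B \<in> B_norm F \<gamma> pick n0 t \<Longrightarrow> w B \<le> (1 + \<sigma>) * h B powr \<gamma>"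
    using A1 \<sigma>(1) unfolding assumption1_def by (metis mult.commute)
  obtain C n2 where n2: "\<And>n0 t0 t. n2 \<le> n0 \<Longrightarrow> is_t0 F \<gamma> pick n0 t0 \<Longrightarrow> t \<in> T_crit F \<gamma> pick n0 \<Longrightarrow> t0 < t \<Longrightarrow>
      1 / real (card (B_ep2 F \<gamma> pick n0 t)) * (\<Sum>B\<in>B_ep2 F \<gamma> pick n0 t. h B / w B) \<le> C * ln (real t)"
    using A2 unfolding assumption2_def by blast
  define K where "K = max 0 C"
  have lim: "eventually (\<lambda>t. real t * ((1 + \<sigma>) * ((1 / (1 / real t + slack \<gamma> t) powr (1 / \<gamma>) - 1) powr (- \<gamma>) / \<gamma>))
      < (1 + \<sigma>) / \<gamma> + \<delta> / 4) sequentially"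
    "eventually (\<lambda>t. real t * ((1 / real t + slack \<gamma> t)\<^sup>2 * ((4 * real t) powr (1 / \<gamma>) * (K * ln (real t))))
      < \<delta> / 4) sequentially"
    using \<delta>(1) by (intro order_tendstoD(2)[OF budget_limit(1)[OF \<gamma>(1)]] order_tendstoD(2)[OF budget_limit(2)[OF \<gamma>(1)]]; simp)+
  obtain n3 where n3: "\<And>t. n3 \<le> t \<Longrightarrow>
      real t * ((1 + \<sigma>) * ((1 / (1 / real t + slack \<gamma> t) powr (1 / \<gamma>) - 1) powr (- \<gamma>) / \<gamma>))
        < (1 + \<sigma>) / \<gamma> + \<delta> / 4 \<and>
      real t * ((1 / real t + slack \<gamma> t)\<^sup>2 * ((4 * real t) powr (1 / \<gamma>) * (K * ln (real t)))) < \<delta> / 4 \<and>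
      2 * (8 / (c * real t)) powr \<gamma> < 1 / real t \<and> (1 / real t + slack \<gamma> t) powr (1 / \<gamma>) < 1"
    using eventually_conj[OF lim(1) eventually_conj[OF lim(2) eventually_conj[OF eventually_bounds[OF \<gamma>(1) c(1)]]]]
    unfolding eventually_sequentially by blast
  have "(\<lambda>n. 32 * sqrt (1 / (real n - 1))) \<longlonglongrightarrow> 0"
    by real_asymp
  then have "eventually (\<lambda>n. 32 * sqrt (1 / (real n - 1)) < \<delta> / 4) sequentially"
    using \<delta>(1) by (intro order_tendstoD(2)[where y = 0]) auto
  then obtain n4 where n4: "\<And>n. n4 \<le> n \<Longrightarrow> 32 * sqrt (1 / (real n - 1)) < \<delta> / 4"
    unfolding eventually_sequentially by blast
  define n5 where "n5 = nat \<lceil>16 / c\<rceil>"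
  have n5: "16 / c \<le> real n5" unfolding n5_def by linarith
  have "slack_pack F \<gamma> pick n0 \<sigma> c K" if n0: "Max {1, n1, n2, n3, n4, n5} \<le> n0" for n0
  proof
    have n: "1 \<le> n0" "n1 \<le> n0" "n2 \<le> n0" "n3 \<le> n0" "n4 \<le> n0" "n5 \<le> n0" using n0 by auto
    show "1 < \<gamma>" "\<gamma> < 2" "max_width_choice pick" "0 \<le> \<sigma>" "\<sigma> \<le> 1" "0 < c" "c \<le> 1" "0 \<le> K"
      using \<gamma> pick \<sigma> c by (auto simp: K_def)
    show "16 / c \<le> real n0" using n(6) n5 by linarith
    show "w B \<le> (1 + \<sigma>) * h B powr \<gamma>" if "B \<in> B_norm F \<gamma> pick n0 t" for t B
      using n1[OF n(2) that] .
    show "1 / real (card (B_ep2 F \<gamma> pick n0 t)) * (\<Sum>B\<in>B_ep2 F \<gamma> pick n0 t. h B / w B) \<le> K * ln (real t)"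
      if "is_t0 F \<gamma> pick n0 t0" "t \<in> T_crit F \<gamma> pick n0" "t0 < t" for t0 t
    proof -
      have "C * ln (real t) \<le> K * ln (real t)"
        using that(3) unfolding K_def by (intro mult_right_mono) auto
      then show ?thesis using n2[OF n(3) that] by linarith
    qed
    fix t assume t: "n0 \<le> t"
    have t3: "n3 \<le> t" "1 \<le> t" using t n by auto
    show "2 * (8 / (c * real t)) powr \<gamma> < 1 / real t" "(1 / real t + slack \<gamma> t) powr (1 / \<gamma>) < 1"
      using n3[OF t3(1)] by auto
    let ?a = "(1 + \<sigma>) * ((1 / (1 / real t + slack \<gamma> t) powr (1 / \<gamma>) - 1) powr (- \<gamma>) / \<gamma>)"
    let ?b = "(1 / real t + slack \<gamma> t) * (16 * sqrt (1 / (real n0 - 1)))"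
    let ?d = "(1 / real t + slack \<gamma> t)\<^sup>2 * ((4 * real t) powr (1 / \<gamma>) * (K * ln (real t)))"
    have "real t * ?b \<le> 32 * sqrt (1 / (real n0 - 1))"
    proof -
      have "real t * (1 / real t + slack \<gamma> t) \<le> 2"
        using slack_le[OF \<gamma>(1) t3(2)] t3(2) by (simp add: field_simps)
      then have "real t * (1 / real t + slack \<gamma> t) * (16 * sqrt (1 / (real n0 - 1)))
          \<le> 2 * (16 * sqrt (1 / (real n0 - 1)))"
        using n(1) by (intro mult_right_mono) auto
      then show ?thesis by (simp only: mult.assoc)
    qed
    then have "real t * (?a + ?b + ?d) < 1 - c"
      using n3[OF t3(1)] n4[OF n(5)] \<sigma>\<gamma> unfolding distrib_left c_def by linarith
    then show "?a + ?b + ?d < (1 - c) * (1 / real t)"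
      using t3(2) by (simp add: less_divide_eq mult.commute)
  qed
  then show ?thesis
    unfolding c_def by (intro exI[of _ "Max {1, n1, n2, n3, n4, n5}"]) auto
qed

theorem theorem1:
  fixes F :: family and \<gamma> :: real and pick :: choice
  assumes "sqrt (3 / 2) < \<gamma>" and "\<gamma> < 3 / 2"
    and "max_width_choice pick"
    and "assumption1 F \<gamma> pick"
    and "assumption2 F \<gamma> pick"
  shows "\<forall>\<delta>>0. \<exists>n1\<ge>1. \<forall>n0\<ge>n1.
           (\<forall>t\<in>T_crit F \<gamma> pick n0. S_LRP F \<gamma> pick n0 t / S_com F t > 1 - 1 / \<gamma> - \<delta>) \<and>
           never_fails F \<gamma> pick n0 \<and>
           perfect_packing F n0 (placement F \<gamma> pick n0)"
proof (intro allI impI)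
  fix \<delta> :: real
  assume "0 < \<delta>"
  have "1 < sqrt (3 / 2 :: real)" by (rule real_less_rsqrt) simp
  then have \<gamma>: "1 < \<gamma>" "\<gamma> < 2" using assms(1,2) by linarith+
  define \<delta>' where "\<delta>' = min \<delta> ((1 - 1 / \<gamma>) / 2)"
  have "1 / \<gamma> < 1" using \<gamma> by simp
  then have \<delta>': "0 < \<delta>'" "\<delta>' < 1 - 1 / \<gamma>" "\<delta>' \<le> \<delta>"
    unfolding \<delta>'_def using \<open>0 < \<delta>\<close> by (auto simp: min_less_iff_disj)
  obtain n1 where n1: "1 \<le> n1"
    "\<And>n0. n1 \<le> n0 \<Longrightarrow> \<exists>\<sigma> K. slack_pack F \<gamma> pick n0 \<sigma> (1 - 1 / \<gamma> - \<delta>') K"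
    using slack_pack_large[OF \<gamma> assms(3-5) \<delta>'(1,2)] by blast
  have "(\<forall>t\<in>T_crit F \<gamma> pick n0. S_LRP F \<gamma> pick n0 t / S_com F t > 1 - 1 / \<gamma> - \<delta>) \<and>
      never_fails F \<gamma> pick n0 \<and> perfect_packing F n0 (placement F \<gamma> pick n0)" if n0: "n1 \<le> n0" for n0
  proof -
    obtain \<sigma> K where sp: "slack_pack F \<gamma> pick n0 \<sigma> (1 - 1 / \<gamma> - \<delta>') K"
      using n1(2)[OF n0] by blast
    show ?thesis
      using slack_pack.critical_ratio[OF sp] slack_pack.never_fails[OF sp] slack_pack.packing[OF sp] \<delta>'(3)
      by force
  qed
  then show "\<exists>n1\<ge>1. \<forall>n0\<ge>n1.
      (\<forall>t\<in>T_crit F \<gamma> pick n0. S_LRP F \<gamma> pick n0 t / S_com F t > 1 - 1 / \<gamma> - \<delta>) \<and>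
      never_fails F \<gamma> pick n0 \<and> perfect_packing F n0 (placement F \<gamma> pick n0)"
    using n1(1) by blast
qed

end
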